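(* Let $r \geq 1$ and let $G = G(r)$, i.e. $G$ is obtained from an $n$-clique cycle $\mathrm{CC}(B_1,\dots,B_n)$ ($n\ge3$) with connecting vertices $x_1,\dots,x_n$ by choosing a nonempty subset $A \subseteq \{x_1,\dots,x_n\}$ and attaching to each $x \in A$ a star-clique graph $\mathrm{SC}(x)$ centered at $x$, such that $|V(\mathrm{SC}(x))| \geq r+1$ for at least one $x \in A$. Then the $r$-independence complex $\mathrm{Ind}_r(G)$ is shellable.
   Context: All graphs are finite and simple. An $n$-clique cycle $\mathrm{CC}(B_1,\dots,B_n)$, $n\ge 3$, is a graph formed by a cyclic sequence of cliques $B_1,\dots,B_n$ in which each consecutive pair $B_i, B_{i+1}$ (indices modulo $n$) intersects in exactly one vertex $x_i$ (so $B_n$ and $B_1$ share $x_n$); the $x_1,\dots,x_n$ are the connecting vertices. A star-clique graph $\mathrm{SC}(x)$ is a graph formed by attaching a collection of cliques (complete graphs, possibly of different sizes) to a central vertex $x$, i.e. each clique contains $x$ and they share no other vertices; the attached star-cliques have vertices other than their center new and pairwise disjoint. For $r \geq 1$, a subset $A' \subseteq V(G)$ is $r$-independent if every connected component of $G[A']$ has at most $r$ vertices; $\mathrm{Ind}_r(G)$ is the simplicial complex on $V(G)$ of all $r$-independent subsets. A (not necessarily pure) simplicial complex is shellable if its facets can be ordered $F_1,\dots,F_t$ so that for each $k>1$, $\langle F_k\rangle \cap \langle F_1,\dots,F_{k-1}\rangle$ is pure of dimension $\dim F_k-1$ ($\langle\mathcal F\rangle$ = complex generated by $\mathcal F$). 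*)

theory Defs
  imports "Graph_Theory.Graph_Theory"
begin

text \<open>
  Finite simple graphs are the symmetric, loop-free, finite pair digraphs of the
  Graph_Theory entry (locale \<^locale>\<open>pair_graph\<close>): every edge is present in both directions.
\<close>

definition clique_on :: "'a set \<Rightarrow> 'a pair_pre_digraph" where
  "clique_on S = \<lparr> pverts = S, parcs = {(u, v). u \<in> S \<and> v \<in> S \<and> u \<noteq> v} \<rparr>"

definition graph_Union :: "'a pair_pre_digraph set \<Rightarrow> 'a pair_pre_digraph" where
  "graph_Union Gs = \<lparr> pverts = (\<Union>G\<in>Gs. pverts G), parcs = (\<Union>G\<in>Gs. parcs G) \<rparr>"

text \<open>
  The cliques are \<open>B 0, \<dots>, B (n - 1)\<close>, with \<open>x i\<close> the vertex shared by \<open>B i\<close> and its cyclic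
  successor.  Non-consecutive cliques are disjoint.  For \<open>n \<ge> 4\<close> this already makes the
  connecting vertices distinct; for \<open>n = 3\<close> the injectivity requirement excludes three cliques
  glued at one common vertex, which do not form a cycle.
\<close>

definition clique_cycle ::
    "nat \<Rightarrow> (nat \<Rightarrow> 'a set) \<Rightarrow> (nat \<Rightarrow> 'a) \<Rightarrow> 'a pair_pre_digraph \<Rightarrow> bool" where
  "clique_cycle n B x H \<longleftrightarrow>
     3 \<le> n \<and>
     (\<forall>i<n. finite (B i)) \<and>
     (\<forall>i<n. B i \<inter> B (Suc i mod n) = {x i}) \<and>
     inj_on x {..<n} \<and>
     (\<forall>i<n. \<forall>j<n. i \<noteq> j \<and> j \<noteq> Suc i mod n \<and> i \<noteq> Suc j mod n \<longrightarrow> B i \<inter> B j = {}) \<and>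
     H = graph_Union (clique_on ` B ` {..<n})"

text \<open>The singleton clique only ensures that the centre is a vertex when \<open>\<C>\<close> is empty.\<close>

definition star_clique :: "'a \<Rightarrow> 'a pair_pre_digraph \<Rightarrow> bool" where
  "star_clique c S \<longleftrightarrow>
     (\<exists>\<C>. finite \<C> \<and>
          (\<forall>K\<in>\<C>. finite K \<and> c \<in> K) \<and>
          (\<forall>K\<in>\<C>. \<forall>L\<in>\<C>. K \<noteq> L \<longrightarrow> K \<inter> L = {c}) \<and>
          S = graph_Union (insert (clique_on {c}) (clique_on ` \<C>)))"

text \<open>
  In a symmetric digraph the strongly connected components are the connected components of the
  undirected graph, and \<^const>\<open>pre_digraph.sccs_verts\<close> is the set of their vertex sets.
\<close>

definition r_independent :: "nat \<Rightarrow> 'a pair_pre_digraph \<Rightarrow> 'a set \<Rightarrow> bool" where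
  "r_independent r G A \<longleftrightarrow>
     A \<subseteq> pverts G \<and> (\<forall>C \<in> pre_digraph.sccs_verts (with_proj G \<restriction> A). card C \<le> r)"

definition Ind :: "nat \<Rightarrow> 'a pair_pre_digraph \<Rightarrow> 'a set set" where
  "Ind r G = {A. r_independent r G A}"

text \<open>
  A finite abstract simplicial complex is represented by its set of faces, the empty face included.
\<close>

definition simplicial_complex :: "'a set set \<Rightarrow> bool" where
  "simplicial_complex K \<longleftrightarrow>
     finite K \<and> {} \<in> K \<and> (\<forall>F\<in>K. finite F) \<and> (\<forall>F\<in>K. \<forall>F'. F' \<subseteq> F \<longrightarrow> F' \<in> K)"

definition facets :: "'a set set \<Rightarrow> 'a set set" where
  "facets K = {F \<in> K. \<forall>F'\<in>K. F \<subseteq> F' \<longrightarrow> F' = F}"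

text \<open>Integer-valued, so that the empty face has dimension \<open>-1\<close>.\<close>

definition face_dim :: "'a set \<Rightarrow> int" where
  "face_dim F = int (card F) - 1"

definition pure_of_dim :: "int \<Rightarrow> 'a set set \<Rightarrow> bool" where
  "pure_of_dim d K \<longleftrightarrow> K \<noteq> {} \<and> (\<forall>F \<in> facets K. face_dim F = d)"

definition generated_complex :: "'a set set \<Rightarrow> 'a set set" where
  "generated_complex \<F> = (\<Union>F\<in>\<F>. Pow F)"

definition shellable :: "'a set set \<Rightarrow> bool" where
  "shellable K \<longleftrightarrow>
     simplicial_complex K \<and>
     (\<exists>Fs. distinct Fs \<and> set Fs = facets K \<and>
       (\<forall>k. 0 < k \<and> k < length Fs \<longrightarrow>
          pure_of_dim (face_dim (Fs ! k) - 1)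
            (generated_complex {Fs ! k} \<inter> generated_complex (set (take k Fs)))))"

lemma pair_graph_clique_on:
  assumes "finite S" shows "pair_graph (clique_on S)"
proof -
  have "{(u, v). u \<in> S \<and> v \<in> S \<and> u \<noteq> v} \<subseteq> S \<times> S" by auto
  then have "finite {(u, v). u \<in> S \<and> v \<in> S \<and> u \<noteq> v}"
    using assms finite_subset by blast
  then show ?thesis
    using assms by unfold_locales (auto simp: clique_on_def symmetric_def intro: symI)
qed

lemma complete_digraph_clique_on:
  assumes "finite S" shows "complete_digraph (card S) (clique_on S)"
proof -
  interpret pair_graph "clique_on S" using assms by (rule pair_graph_clique_on)
  show ?thesis
    unfolding complete_digraph_def using graph_axioms by (auto simp: clique_on_def)
qed

lemma pair_graph_graph_Union:
  assumes "finite Gs" and pg: "\<And>G. G \<in> Gs \<Longrightarrow> pair_graph G"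
  shows "pair_graph (graph_Union Gs)"
proof -
  have wf: "pair_wf_digraph G" and fin: "pair_fin_digraph G"
    and sy: "pair_sym_digraph G" and lf: "pair_loopfree_digraph G" if "G \<in> Gs" for G
    using pg[OF that]
    by (simp_all add: pair_graph_def pair_digraph_def pair_pseudo_graph_def pair_fin_digraph_def)
  show ?thesis
  proof
    fix e assume "e \<in> parcs (graph_Union Gs)"
    then obtain G where G: "G \<in> Gs" "e \<in> parcs G" by (auto simp: graph_Union_def)
    show "fst e \<in> pverts (graph_Union Gs)" "snd e \<in> pverts (graph_Union Gs)"
      using G pair_wf_digraph.arc_fst_in_verts[OF wf[OF G(1)] G(2)]
        pair_wf_digraph.arc_snd_in_verts[OF wf[OF G(1)] G(2)]
      unfolding graph_Union_def by (simp_all, blast+)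
    show "fst e \<noteq> snd e"
      using G pair_loopfree_digraph.pair_no_loops[OF lf] by blast
  next
    show "finite (pverts (graph_Union Gs))" "finite (parcs (graph_Union Gs))"
      using assms(1) pair_fin_digraph.pair_finite_verts[OF fin]
        pair_fin_digraph.pair_finite_arcs[OF fin]
      by (auto simp: graph_Union_def)
  next
    have "sym (parcs G)" if "G \<in> Gs" for G
      using pair_sym_digraph.pair_sym_arcs[OF sy[OF that]] by (simp add: symmetric_def)
    then show "symmetric (with_proj (graph_Union Gs))"
      by (auto simp: symmetric_def graph_Union_def sym_def)
  qed
qed

lemma pair_graph_clique_cycle: "clique_cycle n B x H \<Longrightarrow> pair_graph H"
  unfolding clique_cycle_def by (auto intro!: pair_graph_graph_Union pair_graph_clique_on)

lemma pair_graph_star_clique: "star_clique c S \<Longrightarrow> pair_graph S"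
  unfolding star_clique_def by (auto intro!: pair_graph_graph_Union pair_graph_clique_on)

end

theory Submission
  imports Defs
begin

text \<open>
  Call a complex vertex decomposable if it is \<open>{{}}\<close>, a cone over a vertex decomposable complex,
  or has a shedding vertex whose link and deletion are vertex decomposable; such complexes are
  shellable.  It pays to consider more
  generally the complexes of all \<open>F\<close> for which no connected subset of \<open>F \<union> P\<close> has weight above
  \<open>r\<close>, with forced vertices \<open>P\<close>, so that links stay in the class.

  For a forest with arbitrary vertex weights, look at a deepest vertex \<open>v\<close> whose subtree weighs
  more than \<open>r\<close>.  If \<open>v\<close> is not forced, it is a shedding vertex: every component avoiding \<open>v\<close>
  that meets its subtree is light.  If \<open>v\<close> is forced, the heaviest of the branches hanging below
  the forced part of \<open>v\<close> starts at a shedding vertex.  Block graphs reduce to forests by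
  replacing each clique by a forced vertex of weight \<open>0\<close>.

  In \<open>G(r)\<close>, let \<open>a\<close> be the centre of a star with at least \<open>r\<close> further vertices \<open>Z\<close>.  Then \<open>a\<close> is a
  shedding vertex, and \<open>G - a\<close> is a block graph.  In the link, \<open>a\<close> is forced; as long as the forced
  component of \<open>a\<close> has a neighbour outside \<open>Z\<close>, this neighbour is a shedding vertex, since it can
  be exchanged for a vertex of \<open>Z\<close>.  Once there is none, the component of \<open>a\<close> splits off.
\<close>

section \<open>Vertex decomposable complexes\<close>

text \<open>\<open>L\<close> plays the role of the link of \<open>z\<close> and \<open>D\<close>
  that of its deletion. The last premise of \<open>shed\<close> is the nonpure shedding condition:
  no face of the link is a facet of the deletion. Simplices arise from \<open>empty_face\<close> by
  repeated coning.\<close>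

inductive vertex_decomposable :: "'a set set \<Rightarrow> bool" where
  empty_face: "vertex_decomposable {{}}"
| cone: "vertex_decomposable K \<Longrightarrow> (\<And>F. F \<in> K \<Longrightarrow> z \<notin> F) \<Longrightarrow>
    vertex_decomposable (K \<union> insert z ` K)"
| shed: "vertex_decomposable D \<Longrightarrow> vertex_decomposable L \<Longrightarrow> L \<subseteq> D \<Longrightarrow>
    (\<And>F. F \<in> D \<Longrightarrow> z \<notin> F) \<Longrightarrow> (\<And>F. F \<in> L \<Longrightarrow> \<exists>u. u \<notin> F \<and> insert u F \<in> D) \<Longrightarrow>
    vertex_decomposable (D \<union> insert z ` L)"

lemma simplicial_complex_Un_insert:
  assumes "simplicial_complex D" "simplicial_complex L" "L \<subseteq> D"
  shows "simplicial_complex (D \<union> insert z ` L)"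
proof -
  have D: "finite D" "{} \<in> D" "\<forall>F\<in>D. finite F" "\<And>F F'. F \<in> D \<Longrightarrow> F' \<subseteq> F \<Longrightarrow> F' \<in> D"
    and L: "finite L" "\<forall>F\<in>L. finite F" "\<And>F F'. F \<in> L \<Longrightarrow> F' \<subseteq> F \<Longrightarrow> F' \<in> L"
    using assms unfolding simplicial_complex_def by auto
  have "F' \<in> D \<union> insert z ` L" if F: "F \<in> L" and F': "F' \<subseteq> insert z F" for F F'
  proof (cases "z \<in> F'")
    case True
    have "F' - {z} \<in> L" using L(3)[OF F] F' by blast
    moreover have "F' = insert z (F' - {z})" using True by blast
    ultimately show ?thesis by blast
  next
    case False
    then have "F' \<in> L" using L(3)[OF F] F' by blast
    then show ?thesis using assms(3) by blast
  qed
  then show ?thesis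
    unfolding simplicial_complex_def using D L by (auto 4 3)
qed

lemma vertex_decomposable_imp_simplicial_complex:
  "vertex_decomposable K \<Longrightarrow> simplicial_complex K"
proof (induction rule: vertex_decomposable.induct)
  case empty_face
  show ?case by (simp add: simplicial_complex_def)
qed (simp_all add: simplicial_complex_Un_insert)

section \<open>Facets and shelling orders\<close>

lemma facetsI: "F \<in> K \<Longrightarrow> (\<And>F'. F' \<in> K \<Longrightarrow> F \<subseteq> F' \<Longrightarrow> F' = F) \<Longrightarrow> F \<in> facets K"
  by (auto simp: facets_def)

lemma facetsD: "F \<in> facets K \<Longrightarrow> F' \<in> K \<Longrightarrow> F \<subseteq> F' \<Longrightarrow> F' = F"
  by (auto simp: facets_def)

lemma facets_subset: "facets K \<subseteq> K"
  by (auto simp: facets_def)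

lemma face_in_facet:
  assumes "simplicial_complex K" "F \<in> K"
  shows "\<exists>F'\<in>facets K. F \<subseteq> F'"
proof -
  have "finite K" using assms by (simp add: simplicial_complex_def)
  then obtain M where "M \<in> K" "F \<subseteq> M" "\<forall>b\<in>K. M \<le> b \<longrightarrow> M = b"
    using finite_has_maximal2[of K F] assms by blast
  then show ?thesis unfolding facets_def by blast
qed

text \<open>The usual reformulation of a shelling step: \<open>F\<close> meets the earlier facets in
  a complex generated by faces \<open>F - {x}\<close>, each attained as the intersection with a
  single earlier facet. It is vacuous for empty \<open>\<F>\<close>, so the first facet is no
  exception.\<close>

definition shelling_step :: "'a set set \<Rightarrow> 'a set \<Rightarrow> bool" where
  "shelling_step \<F> F \<longleftrightarrow> (\<forall>F'\<in>\<F>. \<exists>x\<in>F. F \<inter> F' \<subseteq> F - {x} \<and> (\<exists>F''\<in>\<F>. F \<inter> F'' = F - {x}))"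

definition shelling_order :: "'a set set \<Rightarrow> 'a set list \<Rightarrow> bool" where
  "shelling_order K Fs \<longleftrightarrow> distinct Fs \<and> set Fs = facets K \<and>
     (\<forall>k<length Fs. shelling_step (set (take k Fs)) (Fs ! k))"

text \<open>A facet \<open>E\<close> of the intersection lies in some \<open>F \<inter> F'\<close>,
  hence in a set \<open>F - {y}\<close> that itself belongs to the intersection; maximality forces
  equality.\<close>

lemma pure_of_dim_shelling_step:
  assumes "shelling_step \<F> F" "\<F> \<noteq> {}" "finite F"
  shows "pure_of_dim (face_dim F - 1) (generated_complex {F} \<inter> generated_complex \<F>)"
    (is "pure_of_dim _ ?K")
proof -
  have "{} \<in> ?K" using assms(2) by (auto simp: generated_complex_def)
  moreover have "face_dim E = face_dim F - 1" if E: "E \<in> facets ?K" for E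
  proof -
    obtain F' where F': "F' \<in> \<F>" "E \<subseteq> F'" "E \<subseteq> F"
      using E by (auto simp: facets_def generated_complex_def)
    obtain y F'' where y: "y \<in> F" "F \<inter> F' \<subseteq> F - {y}" "F'' \<in> \<F>" "F \<inter> F'' = F - {y}"
      using assms(1) F'(1) unfolding shelling_step_def by blast
    have "F - {y} \<in> ?K" using y by (auto simp: generated_complex_def)
    moreover have "E \<subseteq> F - {y}" using F' y by blast
    ultimately have "E = F - {y}" using E unfolding facets_def by blast
    moreover have "card F = Suc (card (F - {y}))" using card.remove[OF assms(3) y(1)] .
    ultimately show ?thesis by (simp add: face_dim_def)
  qed
  ultimately show ?thesis unfolding pure_of_dim_def by blast
qed

lemma shelling_order_imp_shellable:
  assumes "simplicial_complex K" "shelling_order K Fs"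
  shows "shellable K"
proof -
  have "pure_of_dim (face_dim (Fs ! k) - 1)
      (generated_complex {Fs ! k} \<inter> generated_complex (set (take k Fs)))"
    if k: "0 < k" "k < length Fs" for k
  proof (rule pure_of_dim_shelling_step)
    show "shelling_step (set (take k Fs)) (Fs ! k)"
      using assms(2) k by (simp add: shelling_order_def)
    show "set (take k Fs) \<noteq> {}" using k by auto
    have "Fs ! k \<in> K" using assms(2) nth_mem[OF k(2)]
      by (auto simp: shelling_order_def facets_def)
    then show "finite (Fs ! k)" using assms(1) by (simp add: simplicial_complex_def)
  qed
  then show ?thesis using assms unfolding shellable_def shelling_order_def by blast
qed

lemma shelling_step_insert:
  assumes "shelling_step \<F> F" "z \<notin> F" "\<And>F'. F' \<in> \<F> \<Longrightarrow> z \<notin> F'"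
  shows "shelling_step (insert z ` \<F>) (insert z F)"
  unfolding shelling_step_def
proof (intro ballI)
  fix E assume "E \<in> insert z ` \<F>"
  then obtain F' where F': "F' \<in> \<F>" "E = insert z F'" by blast
  then obtain y F'' where y: "y \<in> F" "F \<inter> F' \<subseteq> F - {y}" "F'' \<in> \<F>" "F \<inter> F'' = F - {y}"
    using assms(1) unfolding shelling_step_def by blast
  have "y \<noteq> z" using y assms(2) by blast
  then have "insert z F \<inter> E \<subseteq> insert z F - {y}"
    "insert z F \<inter> insert z F'' = insert z F - {y}"
    using F' y by blast+
  then show "\<exists>x\<in>insert z F. insert z F \<inter> E \<subseteq> insert z F - {x} \<and>
      (\<exists>F''\<in>insert z ` \<F>. insert z F \<inter> F'' = insert z F - {x})"
    using y by blast
qed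

text \<open>The shedding premise keeps the facets of \<open>D\<close> maximal: a facet of
  \<open>D\<close> contained in \<open>insert z F'\<close> would equal \<open>F'\<close>, which can
  be enlarged inside \<open>D\<close>.\<close>

lemma facets_Un_insert:
  assumes "\<And>F. F \<in> D \<Longrightarrow> z \<notin> F" "L \<subseteq> D"
    and "\<And>F. F \<in> L \<Longrightarrow> \<exists>u. u \<notin> F \<and> insert u F \<in> D"
  shows "facets (D \<union> insert z ` L) = facets D \<union> insert z ` facets L"
proof -
  have L: "z \<notin> F" if "F \<in> L" for F using assms(1,2) that by blast
  have ins: "insert z F \<subseteq> insert z F' \<longleftrightarrow> F \<subseteq> F'" if "F \<in> L" "F' \<in> L" for F F'
    using L[OF that(1)] L[OF that(2)] by blast
  have ins_eq: "insert z F = insert z F' \<longleftrightarrow> F = F'" if "F \<in> L" "F' \<in> L" for F F'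
    using ins[OF that] ins[OF that(2,1)] by blast
  have 1: "F \<in> facets D" if "F \<in> facets (D \<union> insert z ` L)" "F \<in> D" for F
    using that unfolding facets_def by blast
  have 2: "insert z F \<in> insert z ` facets L"
    if "insert z F \<in> facets (D \<union> insert z ` L)" "F \<in> L" for F
  proof -
    have "F' = F" if F': "F' \<in> L" "F \<subseteq> F'" for F'
    proof -
      have "insert z F' = insert z F"
        by (rule facetsD[OF \<open>insert z F \<in> facets _\<close>]) (use F' in auto)
      then show ?thesis using ins_eq \<open>F \<in> L\<close> F' by blast
    qed
    then show ?thesis by (intro imageI facetsI[OF \<open>F \<in> L\<close>])
  qed
  have 3: "F \<in> facets (D \<union> insert z ` L)" if F: "F \<in> facets D" for F
  proof -
    have FD: "F \<in> D" "\<And>F'. F' \<in> D \<Longrightarrow> F \<subseteq> F' \<Longrightarrow> F' = F" using F unfolding facets_def by blast+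
    have False if F': "F' \<in> L" "F \<subseteq> insert z F'" for F'
    proof -
      have "F \<subseteq> F'" using that(2) assms(1)[OF FD(1)] by blast
      then have "F' = F" using FD(2) that(1) assms(2) by blast
      moreover obtain u where "u \<notin> F'" "insert u F' \<in> D" using assms(3)[OF F'(1)] by blast
      ultimately show False using FD(2)[of "insert u F'"] by blast
    qed
    then show ?thesis using FD by (intro facetsI) blast+
  qed
  have 4: "insert z F \<in> facets (D \<union> insert z ` L)" if F: "F \<in> facets L" for F
  proof -
    have FL: "F \<in> L" "\<And>F'. F' \<in> L \<Longrightarrow> F \<subseteq> F' \<Longrightarrow> F' = F" using F unfolding facets_def by blast+
    have "F' = insert z F" if F': "F' \<in> D \<union> insert z ` L" "insert z F \<subseteq> F'" for F'
    proof -
      have "F' \<notin> D" using that(2) assms(1) by blast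
      then obtain F'' where F'': "F' = insert z F''" "F'' \<in> L" using F'(1) by blast
      then have "F \<subseteq> F''" using ins FL(1) that(2) by blast
      then show ?thesis using FL(2) F'' by blast
    qed
    then show ?thesis using FL(1) by (intro facetsI) blast+
  qed
  show ?thesis
  proof (intro subset_antisym subsetI)
    fix F assume F: "F \<in> facets (D \<union> insert z ` L)"
    then consider "F \<in> D" | F' where "F = insert z F'" "F' \<in> L" unfolding facets_def by blast
    then show "F \<in> facets D \<union> insert z ` facets L"
      using 1 2 F by cases auto
  next
    fix F assume "F \<in> facets D \<union> insert z ` facets L"
    then show "F \<in> facets (D \<union> insert z ` L)" using 3 4 by blast
  qed
qed

lemma facets_cone:
  assumes "\<And>F. F \<in> K \<Longrightarrow> z \<notin> F"
  shows "facets (K \<union> insert z ` K) = insert z ` facets K"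
proof -
  have ins: "insert z F \<subseteq> insert z F' \<longleftrightarrow> F \<subseteq> F'" if "F \<in> K" "F' \<in> K" for F F'
    using assms that by blast
  have ins_eq: "insert z F = insert z F' \<longleftrightarrow> F = F'" if "F \<in> K" "F' \<in> K" for F F'
    using ins[OF that] ins[OF that(2,1)] by blast
  have K: "F \<notin> facets (K \<union> insert z ` K)" if "F \<in> K" for F
    using that assms[OF that] unfolding facets_def by blast
  have iff: "insert z F \<in> facets (K \<union> insert z ` K) \<longleftrightarrow> F \<in> facets K" if F: "F \<in> K" for F
  proof -
    have "insert z F \<in> facets (K \<union> insert z ` K) \<longleftrightarrow>
        (\<forall>F'\<in>insert z ` K. insert z F \<subseteq> F' \<longrightarrow> F' = insert z F)"
      unfolding facets_def using F assms by blast
    also have "\<dots> \<longleftrightarrow> F \<in> facets K"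
      unfolding facets_def using F ins ins_eq by auto
    finally show ?thesis .
  qed
  show ?thesis
  proof (intro subset_antisym subsetI)
    fix F assume F: "F \<in> facets (K \<union> insert z ` K)"
    then have "F \<in> insert z ` K" using K facets_subset[of "K \<union> insert z ` K"] by blast
    then show "F \<in> insert z ` facets K" using iff F by blast
  next
    fix F assume "F \<in> insert z ` facets K"
    then show "F \<in> facets (K \<union> insert z ` K)" using iff facets_subset[of K] by blast
  qed
qed

lemma shelling_order_cone:
  assumes "shelling_order K Fs" "\<And>F. F \<in> K \<Longrightarrow> z \<notin> F"
  shows "shelling_order (K \<union> insert z ` K) (map (insert z) Fs)"
proof -
  have Fs: "z \<notin> F" if "F \<in> set Fs" for F
    using assms that by (auto simp: shelling_order_def facets_def)
  have "inj_on (insert z) (set Fs)" by (intro inj_onI) (metis Fs insert_ident)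
  moreover have "shelling_step (set (take k (map (insert z) Fs))) (map (insert z) Fs ! k)"
    if k: "k < length Fs" for k
    using shelling_step_insert[of "set (take k Fs)" "Fs ! k" z] assms(1) k Fs in_set_takeD[of _ k Fs]
    by (auto simp: shelling_order_def take_map)
  ultimately show ?thesis
    using assms(1) facets_cone[OF assms(2)] by (auto simp: shelling_order_def distinct_map)
qed

text \<open>The facets of the deletion come first, those containing \<open>z\<close> afterwards.
  Among the latter the steps are inherited from \<open>L\<close>; against the former, removing
  \<open>z\<close> works, because every face of the link lies in a facet of the deletion.\<close>

lemma shelling_order_shed:
  assumes "shelling_order D Fs" "shelling_order L Gs" "simplicial_complex D" "L \<subseteq> D"
    and "\<And>F. F \<in> D \<Longrightarrow> z \<notin> F"
    and "\<And>F. F \<in> L \<Longrightarrow> \<exists>u. u \<notin> F \<and> insert u F \<in> D"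
  shows "shelling_order (D \<union> insert z ` L) (Fs @ map (insert z) Gs)"
proof -
  have Fs: "z \<notin> F" if "F \<in> set Fs" for F
    using assms(1,5) that by (auto simp: shelling_order_def facets_def)
  have Gs: "F \<in> L" if "F \<in> set Gs" for F
    using assms(2) that by (auto simp: shelling_order_def facets_def)
  have Gz: "z \<notin> F" if "F \<in> set Gs" for F
    using Gs[OF that] assms(4,5) by blast
  have "inj_on (insert z) (set Gs)" by (intro inj_onI) (metis Gz insert_ident)
  then have dist: "distinct (Fs @ map (insert z) Gs)"
    using assms(1,2) Fs by (auto simp: shelling_order_def distinct_map)
  have "shelling_step (set (take k (Fs @ map (insert z) Gs))) ((Fs @ map (insert z) Gs) ! k)"
    if k: "k < length Fs + length Gs" for k
  proof (cases "k < length Fs")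
    case True
    then show ?thesis using assms(1) by (simp add: shelling_order_def nth_append)
  next
    case False
    define l where "l = k - length Fs"
    have l: "l < length Gs" using False k by (simp add: l_def)
    let ?G = "Gs ! l" and ?\<G> = "set (take l Gs)"
    have G: "?G \<in> set Gs" using l by simp
    have "shelling_step ?\<G> ?G" using assms(2) l by (simp add: shelling_order_def)
    then have st: "shelling_step (insert z ` ?\<G>) (insert z ?G)"
      using shelling_step_insert Gz G in_set_takeD by metis
    obtain F0 where F0: "F0 \<in> set Fs" "?G \<subseteq> F0"
      using face_in_facet[OF assms(3), of ?G] Gs[OF G] assms(1,4)
      by (auto simp: shelling_order_def)
    have z: "insert z ?G \<inter> F0 = insert z ?G - {z}" using F0 Fs[OF F0(1)] Gz[OF G] by blast
    have "shelling_step (set Fs \<union> insert z ` ?\<G>) (insert z ?G)"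
      unfolding shelling_step_def
    proof (intro ballI)
      fix E assume "E \<in> set Fs \<union> insert z ` ?\<G>"
      then consider "E \<in> set Fs" | "E \<in> insert z ` ?\<G>" by blast
      then show "\<exists>x\<in>insert z ?G. insert z ?G \<inter> E \<subseteq> insert z ?G - {x} \<and>
        (\<exists>F''\<in>set Fs \<union> insert z ` ?\<G>. insert z ?G \<inter> F'' = insert z ?G - {x})"
      proof cases
        case 1
        then have "insert z ?G \<inter> E \<subseteq> insert z ?G - {z}" using Fs by blast
        then show ?thesis using z F0(1) by blast
      next
        case 2
        from bspec[OF st[unfolded shelling_step_def] this] obtain y F''
          where "y \<in> insert z ?G" "insert z ?G \<inter> E \<subseteq> insert z ?G - {y}"
            "F'' \<in> insert z ` ?\<G>" "insert z ?G \<inter> F'' = insert z ?G - {y}" by (elim bexE conjE)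
        then show ?thesis by (intro bexI[of _ y] conjI bexI[of _ F'']) simp_all
      qed
    qed
    then show ?thesis using False l by (simp add: nth_append take_map l_def)
  qed
  then show ?thesis
    using assms(1,2) dist facets_Un_insert[OF assms(5,4,6)] by (simp add: shelling_order_def)
qed

theorem vertex_decomposable_imp_shellable:
  assumes "vertex_decomposable K"
  shows "shellable K"
proof -
  have "\<exists>Fs. shelling_order K Fs"
    using assms
  proof (induction rule: vertex_decomposable.induct)
    case empty_face
    have "shelling_order {{}} [{}]"
      by (auto simp: shelling_order_def facets_def shelling_step_def)
    then show ?case by blast
  next
    case (cone K z)
    then show ?case using shelling_order_cone[of K _ z] by metis
  next
    case (shed D L z)
    obtain Fs Gs where "shelling_order D Fs" "shelling_order L Gs" using shed.IH by blast
    from shelling_order_shed[OF this _ shed.hyps(3,4,5)] show ?case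
      using vertex_decomposable_imp_simplicial_complex[OF shed.hyps(1)] by blast
  qed
  then show ?thesis
    using assms vertex_decomposable_imp_simplicial_complex shelling_order_imp_shellable by blast
qed

text \<open>Serves to strip the tag \<open>Inl\<close> from the vertices of the auxiliary forests
  built below.\<close>

lemma vertex_decomposable_image:
  assumes "vertex_decomposable K" "inj_on f (\<Union>K)"
  shows "vertex_decomposable ((`) f ` K)"
  using assms
proof (induction rule: vertex_decomposable.induct)
  case empty_face
  show ?case by (simp add: vertex_decomposable.empty_face)
next
  case (cone K z)
  have inj: "inj_on f (\<Union>K)" "\<And>F. F \<in> K \<Longrightarrow> inj_on f (insert z F)"
    by (rule inj_on_subset[OF cone.prems]; blast)+
  have "f z \<notin> f ` F" if "F \<in> K" for F
    using inj(2)[OF that] cone.hyps(2)[OF that] inj_on_image_mem_iff by fastforce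
  then have "vertex_decomposable ((`) f ` K \<union> insert (f z) ` (`) f ` K)"
    by (intro vertex_decomposable.cone cone.IH inj) auto
  then show ?case by (simp add: image_Un image_image)
next
  case (shed D L z)
  have inj: "inj_on f (\<Union>D)" "inj_on f (\<Union>L)"
    using inj_on_subset[OF shed.prems] shed.hyps(3) by blast+
  show ?case
  \<comment> \<open>Injectivity of \<open>f\<close> is known at \<open>z\<close> only if
    \<open>z\<close> occurs in some face, that is, for nonempty \<open>L\<close>.\<close>
  proof (cases "L = {}")
    case True
    then show ?thesis using shed.IH(1) inj by simp
  next
    case False
    have zin: "z \<in> \<Union>(D \<union> insert z ` L)" using False by blast
    have "f z \<notin> f ` F" if "F \<in> D" for F
    proof
      assume "f z \<in> f ` F"
      then obtain w where "w \<in> F" "f w = f z" by force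
      moreover have "w \<in> \<Union>(D \<union> insert z ` L)" using that \<open>w \<in> F\<close> by blast
      ultimately have "w = z" using inj_onD[OF shed.prems] zin by blast
      then show False using shed.hyps(4)[OF that] \<open>w \<in> F\<close> by blast
    qed
    moreover have "\<exists>u. u \<notin> f ` F \<and> insert u (f ` F) \<in> (`) f ` D" if F: "F \<in> L" for F
    proof -
      obtain u where u: "u \<notin> F" "insert u F \<in> D" using shed.hyps(5)[OF F] by blast
      have "inj_on f (insert u F)" by (rule inj_on_subset[OF inj(1)]) (use u(2) in blast)
      then have "f u \<notin> f ` F" using u(1) by (auto simp: inj_on_def)
      then show ?thesis using u(2) by (metis image_eqI image_insert)
    qed
    ultimately have "vertex_decomposable ((`) f ` D \<union> insert (f z) ` (`) f ` L)"
      using shed.IH inj shed.hyps(3) by (intro vertex_decomposable.shed) auto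
    then show ?thesis by (simp add: image_Un image_image)
  qed
qed

section \<open>Sets of bounded component weight\<close>

text \<open>Connectedness without paths: no nonempty proper subset of \<open>C\<close> is closed
  under passing along \<open>E\<close> inside \<open>C\<close>. For symmetric \<open>E\<close> this
  is connectedness of the induced graph, the empty set included.\<close>

definition linked :: "('a \<Rightarrow> 'a \<Rightarrow> bool) \<Rightarrow> 'a set \<Rightarrow> bool" where
  "linked E C \<longleftrightarrow> (\<forall>X\<subseteq>C. X \<noteq> {} \<and> (\<forall>x\<in>X. \<forall>y\<in>C. E x y \<longrightarrow> y \<in> X) \<longrightarrow> X = C)"

lemma linkedI:
  "(\<And>X. X \<subseteq> C \<Longrightarrow> X \<noteq> {} \<Longrightarrow> (\<And>x y. x \<in> X \<Longrightarrow> y \<in> C \<Longrightarrow> E x y \<Longrightarrow> y \<in> X) \<Longrightarrow> C \<subseteq> X) \<Longrightarrow> linked E C"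
  unfolding linked_def by (metis subset_antisym)

lemma linkedD:
  "linked E C \<Longrightarrow> X \<subseteq> C \<Longrightarrow> X \<noteq> {} \<Longrightarrow> (\<And>x y. x \<in> X \<Longrightarrow> y \<in> C \<Longrightarrow> E x y \<Longrightarrow> y \<in> X) \<Longrightarrow> X = C"
  unfolding linked_def by blast

lemma linked_boundary:
  assumes "linked E C" "X \<subseteq> C" "X \<noteq> {}" "X \<noteq> C"
  obtains x y where "x \<in> X" "y \<in> C" "y \<notin> X" "E x y"
  using linkedD[OF assms(1-3)] assms(4) by blast

text \<open>For symmetric \<open>E\<close> the complement of a closed set is closed too, so it
  suffices to test the closed sets through one base vertex.\<close>

lemma linkedI_base:
  assumes "symp E" "v \<in> C"
    and "\<And>X. X \<subseteq> C \<Longrightarrow> v \<in> X \<Longrightarrow> (\<And>x y. x \<in> X \<Longrightarrow> y \<in> C \<Longrightarrow> E x y \<Longrightarrow> y \<in> X) \<Longrightarrow> C \<subseteq> X"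
  shows "linked E C"
proof (rule linkedI)
  fix X assume X: "X \<subseteq> C" "X \<noteq> {}" "\<And>x y. x \<in> X \<Longrightarrow> y \<in> C \<Longrightarrow> E x y \<Longrightarrow> y \<in> X"
  have "v \<in> X"
  proof (rule ccontr)
    assume "v \<notin> X"
    moreover have "y \<in> C - X" if "x \<in> C - X" "y \<in> C" "E x y" for x y
      using that X(3)[of y x] sympD[OF assms(1)] by blast
    ultimately have "C \<subseteq> C - X" using assms(2) by (intro assms(3)) auto
    then show False using X(1,2) by blast
  qed
  then show "C \<subseteq> X" using assms(3) X(1,3) by blast
qed

lemma linked_empty: "linked E {}"
  by (simp add: linked_def)

lemma linked_singleton: "linked E {v}"
  unfolding linked_def by blast

lemma linked_Un:
  assumes "linked E C" "linked E D" "C \<inter> D \<noteq> {}"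
  shows "linked E (C \<union> D)"
proof (rule linkedI)
  fix X assume X: "X \<subseteq> C \<union> D" "X \<noteq> {}" "\<And>x y. x \<in> X \<Longrightarrow> y \<in> C \<union> D \<Longrightarrow> E x y \<Longrightarrow> y \<in> X"
  have C: "C \<subseteq> X" if "X \<inter> C \<noteq> {}" using linkedD[OF assms(1), of "X \<inter> C"] that X(3) by blast
  have D: "D \<subseteq> X" if "X \<inter> D \<noteq> {}" using linkedD[OF assms(2), of "X \<inter> D"] that X(3) by blast
  show "C \<union> D \<subseteq> X" using C D X(1,2) assms(3) by blast
qed

lemma linked_Un_edge:
  assumes "symp E" "linked E C" "linked E D" "x \<in> C" "y \<in> D" "E x y"
  shows "linked E (C \<union> D)"
proof -
  have "linked E {x, y}"
    by (rule linkedI_base[OF assms(1), of x]) (use assms(6) in auto)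
  then have "linked E (C \<union> {x, y})" using assms(2,4) by (intro linked_Un) auto
  then have "linked E (C \<union> {x, y} \<union> D)" by (rule linked_Un) (use assms(3,5) in auto)
  then show ?thesis using assms(4,5) by (simp add: insert_absorb)
qed

section \<open>Complexes of bounded component weight, their links and deletions\<close>

text \<open>All connected subsets are tested, not just components; for finite \<open>A\<close> this
  is equivalent, as weights are nonnegative, and monotonicity in \<open>A\<close> becomes
  immediate.\<close>

definition bounded_weight :: "('a \<Rightarrow> 'a \<Rightarrow> bool) \<Rightarrow> ('a \<Rightarrow> nat) \<Rightarrow> nat \<Rightarrow> 'a set \<Rightarrow> bool" where
  "bounded_weight E m r A \<longleftrightarrow> (\<forall>C\<subseteq>A. linked E C \<longrightarrow> sum m C \<le> r)"

lemma bounded_weight_subset: "bounded_weight E m r A \<Longrightarrow> A' \<subseteq> A \<Longrightarrow> bounded_weight E m r A'"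
  unfolding bounded_weight_def by blast

lemma bounded_weightD: "bounded_weight E m r A \<Longrightarrow> C \<subseteq> A \<Longrightarrow> linked E C \<Longrightarrow> sum m C \<le> r"
  unfolding bounded_weight_def by blast

lemma bounded_weight_insert:
  assumes "bounded_weight E m r A"
    and "\<And>C. C \<subseteq> insert u A \<Longrightarrow> u \<in> C \<Longrightarrow> linked E C \<Longrightarrow> sum m C \<le> r"
  shows "bounded_weight E m r (insert u A)"
  unfolding bounded_weight_def
  using assms bounded_weightD[OF assms(1)] by (metis subset_insert)

text \<open>The vertices in \<open>P\<close> are forced: a face is a set \<open>F\<close> for which \<open>F \<union> P\<close> is admissible, so that
  links of vertices are again of this form.\<close>

definition bounded_faces ::
    "('a \<Rightarrow> 'a \<Rightarrow> bool) \<Rightarrow> ('a \<Rightarrow> nat) \<Rightarrow> nat \<Rightarrow> 'a set \<Rightarrow> 'a set \<Rightarrow> 'a set set" where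
  "bounded_faces E m r V P = {F. F \<subseteq> V \<and> bounded_weight E m r (F \<union> P)}"

lemma bounded_faces_delete:
  assumes "\<not> bounded_weight E m r (insert z P)"
  shows "bounded_faces E m r V P = bounded_faces E m r (V - {z}) P"
proof -
  have "z \<notin> F" if "bounded_weight E m r (F \<union> P)" for F
    using assms bounded_weight_subset[OF that, of "insert z P"] by blast
  then show ?thesis unfolding bounded_faces_def by blast
qed

lemma bounded_faces_split:
  assumes "z \<in> V"
  shows "bounded_faces E m r V P = bounded_faces E m r (V - {z}) P \<union>
    insert z ` bounded_faces E m r (V - {z}) (insert z P)" (is "?K = ?D \<union> insert z ` ?L")
proof (intro subset_antisym subsetI)
  fix F assume F: "F \<in> ?K"
  show "F \<in> ?D \<union> insert z ` ?L"
  proof (cases "z \<in> F")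
    case True
    then have "F - {z} \<union> insert z P = F \<union> P" by blast
    then have "F - {z} \<in> ?L" using F by (auto simp: bounded_faces_def)
    then show ?thesis using True by (metis UnCI image_eqI insert_Diff)
  next
    case False
    then show ?thesis using F by (auto simp: bounded_faces_def)
  qed
next
  fix F assume "F \<in> ?D \<union> insert z ` ?L"
  then show "F \<in> ?K" using assms by (auto simp: bounded_faces_def)
qed

text \<open>The link of \<open>z\<close> is a complex of the same kind, with \<open>z\<close> moved
  to the forced vertices. If \<open>insert z P\<close> is already too heavy, then \<open>z\<close>
  lies in no face and the complex equals its deletion.\<close>

lemma vertex_decomposable_bounded_faces_shed:
  assumes "z \<in> V" "vertex_decomposable (bounded_faces E m r (V - {z}) P)"
    and "bounded_weight E m r (insert z P) \<Longrightarrow>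
      vertex_decomposable (bounded_faces E m r (V - {z}) (insert z P))"
    and "\<And>F. F \<subseteq> V - {z} \<Longrightarrow> bounded_weight E m r (insert z (F \<union> P)) \<Longrightarrow>
      \<exists>u\<in>V - {z} - F. bounded_weight E m r (insert u (F \<union> P))"
  shows "vertex_decomposable (bounded_faces E m r V P)"
proof (cases "bounded_weight E m r (insert z P)")
  case False
  then show ?thesis using assms(2) bounded_faces_delete by metis
next
  case True
  show ?thesis
    unfolding bounded_faces_split[OF assms(1)]
  proof (rule vertex_decomposable.shed[OF assms(2) assms(3)[OF True]])
    show "bounded_faces E m r (V - {z}) (insert z P) \<subseteq> bounded_faces E m r (V - {z}) P"
      by (auto simp: bounded_faces_def elim!: bounded_weight_subset)
    fix F
    show "F \<in> bounded_faces E m r (V - {z}) P \<Longrightarrow> z \<notin> F" by (auto simp: bounded_faces_def)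
    assume "F \<in> bounded_faces E m r (V - {z}) (insert z P)"
    then show "\<exists>u. u \<notin> F \<and> insert u F \<in> bounded_faces E m r (V - {z}) P"
      using assms(4)[of F] by (auto simp: bounded_faces_def)
  qed
qed

lemma vertex_decomposable_bounded_faces_cone:
  assumes "z \<in> V" "vertex_decomposable (bounded_faces E m r (V - {z}) P)"
    and "\<And>F. F \<subseteq> V - {z} \<Longrightarrow> bounded_weight E m r (F \<union> P) \<Longrightarrow> bounded_weight E m r (insert z (F \<union> P))"
  shows "vertex_decomposable (bounded_faces E m r V P)"
proof -
  have "bounded_faces E m r (V - {z}) (insert z P) = bounded_faces E m r (V - {z}) P"
    using assms(3) by (auto simp: bounded_faces_def dest: bounded_weight_subset[OF _ subset_insertI])
  then show ?thesis
    unfolding bounded_faces_split[OF assms(1)]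
    using vertex_decomposable.cone[OF assms(2), of z] by (auto simp: bounded_faces_def)
qed

section \<open>Rooted forests given by a parent map and a depth\<close>

locale depth_forest =
  fixes par :: "'a \<Rightarrow> 'a" and d :: "'a \<Rightarrow> nat"
begin

text \<open>A vertex that is not deeper than its \<open>par\<close> value is a root, so that no assumptions on
  \<open>par\<close> and \<open>d\<close> are needed.\<close>

definition adj :: "'a \<Rightarrow> 'a \<Rightarrow> bool" where
  "adj x y \<longleftrightarrow> (d y < d x \<and> y = par x) \<or> (d x < d y \<and> x = par y)"

lemma symp_adj: "symp adj"
  by (auto simp: symp_def adj_def)

text \<open>The path from a member up to \<open>v\<close> has to stay inside \<open>W\<close>.
  Hence, for forced \<open>P\<close>, \<open>subtree P v\<close> is the part of the subtree joined
  to \<open>v\<close> by forced vertices. For \<open>v \<notin> W\<close> the set is empty.\<close>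

inductive_set subtree :: "'a set \<Rightarrow> 'a \<Rightarrow> 'a set" for W v where
  root: "v \<in> W \<Longrightarrow> v \<in> subtree W v"
| child: "w \<in> W \<Longrightarrow> d (par w) < d w \<Longrightarrow> par w \<in> subtree W v \<Longrightarrow> w \<in> subtree W v"

lemma subtree_subset: "subtree W v \<subseteq> W"
  by (auto elim: subtree.cases)

lemma subtree_mono:
  assumes "W \<subseteq> W'"
  shows "subtree W v \<subseteq> subtree W' v"
proof
  fix w assume "w \<in> subtree W v"
  then show "w \<in> subtree W' v"
    by induction (use assms in \<open>auto intro: subtree.intros\<close>)
qed

lemma subtree_depth: "w \<in> subtree W v \<Longrightarrow> w \<noteq> v \<Longrightarrow> d v < d w"
  by (induction rule: subtree.induct) force+

lemma subtree_trans:
  assumes "w \<in> subtree W u" "u \<in> subtree W v"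
  shows "w \<in> subtree W v"
  using assms by induction (auto intro: subtree.child)

lemma subtree_par:
  assumes "w \<in> subtree W v" "w \<noteq> v"
  shows "d (par w) < d w" "par w \<in> subtree W v"
  using assms by (auto elim: subtree.cases)

text \<open>Children in \<open>W\<close> of members are members, and so are the parents of members
  other than \<open>v\<close>; this leaves only the edge going up from \<open>v\<close>.\<close>

lemma adj_boundary_subtree:
  assumes "x \<in> subtree W v" "y \<in> W" "y \<notin> subtree W v" "adj x y"
  shows "x = v \<and> y = par v \<and> d y < d v"
proof -
  have "\<not> (d x < d y \<and> x = par y)" using assms subtree.child by blast
  then have "d y < d x" "y = par x" using assms(4) by (auto simp: adj_def)
  then show ?thesis using subtree_par(2)[OF assms(1)] assms(3) by blast
qed

lemma linked_subtree: "linked adj (subtree W v)"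
proof (cases "v \<in> subtree W v")
  case True
  show ?thesis
  proof (rule linkedI_base[OF symp_adj True])
    fix X assume X: "v \<in> X" "\<And>x y. x \<in> X \<Longrightarrow> y \<in> subtree W v \<Longrightarrow> adj x y \<Longrightarrow> y \<in> X"
    show "subtree W v \<subseteq> X"
    proof
      fix w assume "w \<in> subtree W v"
      then show "w \<in> X"
      proof induction
        case root
        show ?case by fact
      next
        case (child w)
        moreover have "adj (par w) w" using child by (simp add: adj_def)
        ultimately show ?case using X(2) subtree.child by blast
      qed
    qed
  qed
next
  case False
  have "w \<notin> subtree W v" for w
  proof
    assume "w \<in> subtree W v"
    then show False by induction (use False subtree.root in blast)+
  qed
  then have "subtree W v = {}" by blast
  then show ?thesis by (simp add: linked_empty)
qed

text \<open>For \<open>t\<close> of least depth, the only edge that could leave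
  \<open>subtree C t\<close> leads to the parent of \<open>t\<close>, which is too shallow to be in
  \<open>C\<close>.\<close>

lemma linked_top:
  assumes "linked adj C" "C \<noteq> {}" "finite C"
  obtains t where "t \<in> C" "C = subtree C t"
proof -
  have "\<exists>t\<in>C. \<forall>w\<in>C. d t \<le> d w"
    using arg_min_least[OF assms(3,2), of _ d] arg_min_if_finite(1)[OF assms(3,2), of d] by blast
  then obtain t where t: "t \<in> C" "\<And>w. w \<in> C \<Longrightarrow> d t \<le> d w" by blast
  have "subtree C t = C"
  proof (rule ccontr)
    assume "subtree C t \<noteq> C"
    then obtain x y where "x \<in> subtree C t" "y \<in> C" "y \<notin> subtree C t" "adj x y"
      using linked_boundary[OF assms(1) subtree_subset, of t] subtree.root[OF t(1)] by blast
    then show False using adj_boundary_subtree t(2) leD by blast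
  qed
  then show ?thesis using that t by blast
qed

text \<open>Climbing from \<open>u\<close> to \<open>t\<close> stays inside \<open>C\<close>, so it
  never passes \<open>v\<close> and remains in the subtree of \<open>v\<close>.\<close>

lemma subtree_linear:
  assumes "u \<in> subtree C t" "u \<in> subtree W v" "C \<subseteq> W" "v \<notin> C"
  shows "t \<in> subtree W v"
  using assms(1,2)
proof induction
  case root
  then show ?case by simp
next
  case (child w)
  moreover have "w \<noteq> v" using child.hyps(1) assms(4) by blast
  ultimately show ?case using subtree_par by blast
qed

lemma linked_avoiding_root:
  assumes "linked adj C" "finite C" "C \<subseteq> W" "v \<notin> C" "u \<in> C" "u \<in> subtree W v"
  obtains t where "d v < d t" "C \<subseteq> subtree W t" "t \<in> subtree W v" "t \<in> C"
proof -
  obtain t where t: "t \<in> C" "C = subtree C t" using linked_top assms by blast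
  have "t \<in> subtree W v" using subtree_linear[of u C t W v] assms t by blast
  moreover have "d v < d t" using subtree_depth[OF calculation] t assms(4) by blast
  ultimately show ?thesis using that t subtree_mono[OF assms(3), of t] by blast
qed

text \<open>The branch at \<open>c\<close> is joined to the rest of \<open>C\<close> only through
  \<open>par c\<close>, so cutting it off separates nothing else.\<close>

lemma linked_Diff_subtree:
  assumes "linked adj C" "C \<subseteq> W"
  shows "linked adj (C - subtree W c)"
proof (rule linkedI)
  let ?S = "subtree W c"
  fix X assume X: "X \<subseteq> C - ?S" "X \<noteq> {}"
    and cl: "\<And>x y. x \<in> X \<Longrightarrow> y \<in> C - ?S \<Longrightarrow> adj x y \<Longrightarrow> y \<in> X"
  \<comment> \<open>A closed subset of the rest becomes closed in \<open>C\<close> if the branch is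
    added exactly when its attaching vertex \<open>par c\<close> is present.\<close>
  define Y where "Y = X \<union> (if par c \<in> X then C \<inter> ?S else {})"
  have "Y = C"
  proof (rule linkedD[OF assms(1)])
    show "Y \<subseteq> C" "Y \<noteq> {}" using X by (auto simp: Y_def)
    fix x y assume xy: "x \<in> Y" "y \<in> C" "adj x y"
    then have yx: "adj y x" using symp_adj by (auto dest: sympD)
    show "y \<in> Y"
    proof (cases "x \<in> ?S")
      case True
      then have p: "par c \<in> X" "x \<in> C" using xy(1) X(1) by (auto simp: Y_def split: if_splits)
      then show ?thesis
        using adj_boundary_subtree[OF True _ _ xy(3)] xy(2) assms(2) by (auto simp: Y_def)
    next
      case False
      then have x: "x \<in> X" "x \<in> C" using xy(1) X(1) by (auto simp: Y_def split: if_splits)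
      show ?thesis
      proof (cases "y \<in> ?S")
        case True
        then have "x = par c" using adj_boundary_subtree[OF True _ False yx] x(2) assms(2) by blast
        then show ?thesis using x xy(2) True by (simp add: Y_def)
      next
        case False
        then show ?thesis using cl[OF x(1) _ xy(3)] xy(2) by (simp add: Y_def)
      qed
    qed
  qed
  then show "C - ?S \<subseteq> X" by (auto simp: Y_def split: if_splits)
qed

text \<open>\<open>c\<close> is the first vertex outside \<open>P\<close> on the way down from
  \<open>v\<close> to \<open>u\<close>.\<close>

lemma subtree_branch:
  assumes "u \<in> subtree W v" "v \<in> P"
  shows "u \<in> subtree P v \<or>
    (\<exists>c\<in>W - P. d (par c) < d c \<and> par c \<in> subtree P v \<and> u \<in> subtree W c)"
  using assms(1)
proof induction
  case root
  then show ?case using assms(2) subtree.root by blast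
next
  case (child w)
  from child.IH show ?case
  proof
    assume p: "par w \<in> subtree P v"
    show ?case
    proof (cases "w \<in> P")
      case True
      then show ?thesis using subtree.child p child.hyps by blast
    next
      case False
      then show ?thesis using p child.hyps subtree.root by blast
    qed
  next
    assume "\<exists>c\<in>W - P. d (par c) < d c \<and> par c \<in> subtree P v \<and> par w \<in> subtree W c"
    then show ?thesis using subtree.child child.hyps by blast
  qed
qed

end

section \<open>Weighted forests\<close>

lemma finite_has_maximal_value:
  fixes f :: "'a \<Rightarrow> nat"
  assumes "finite S" "S \<noteq> {}"
  shows "\<exists>x\<in>S. \<forall>y\<in>S. f y \<le> f x"
proof -
  have "Max (f ` S) \<in> f ` S" using assms by (intro Max_in) auto
  then obtain x where "x \<in> S" "Max (f ` S) = f x" by blast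
  moreover have "f y \<le> Max (f ` S)" if "y \<in> S" for y using assms(1) that by simp
  ultimately show ?thesis by metis
qed

context depth_forest
begin

text \<open>A connected set through \<open>u\<close> that avoids \<open>v\<close> is contained in a
  single subtree rooted deeper than \<open>v\<close>, which is light by \<open>deep\<close>.\<close>

lemma exchange_forest_vertex:
  assumes W: "finite W" "F \<subseteq> W" "v \<in> W" "v \<notin> F"
    and deep: "\<And>w. w \<in> W \<Longrightarrow> d v < d w \<Longrightarrow> sum m (subtree W w) \<le> r"
    and F: "bounded_weight adj m r F"
    and u: "u \<in> subtree W v" "u \<noteq> v"
  shows "bounded_weight adj m r (insert u F)"
proof (rule bounded_weight_insert[OF F])
  fix C assume C: "C \<subseteq> insert u F" "u \<in> C" "linked adj C"
  have CW: "C \<subseteq> W" using C(1) W(2) u(1) subtree_subset by blast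
  have "v \<notin> C" using C(1) W(4) u(2) by blast
  then obtain t where t: "d v < d t" "C \<subseteq> subtree W t" "t \<in> subtree W v"
    using linked_avoiding_root[OF C(3) finite_subset[OF CW W(1)] CW _ C(2) u(1)] by blast
  have fin: "finite (subtree W t)" using W(1) subtree_subset finite_subset by blast
  have "sum m C \<le> sum m (subtree W t)" using t(2) by (intro sum_mono2[OF fin]) auto
  also have "\<dots> \<le> r" using deep t subtree_subset by blast
  finally show "sum m C \<le> r" .
qed

text \<open>If \<open>v\<close> is forced, then so is the part \<open>Q\<close> of its subtree that is joined to it by forced
  vertices, and the rest of the subtree consists of branches at \<open>Q\<close>.  Among these the branch
  at \<open>c\<close> is the heaviest one, so it can be exchanged for a part of any other one.\<close>

lemma exchange_forest_branch:
  fixes m :: "'a \<Rightarrow> nat"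
  assumes W: "finite W" "P \<subseteq> F" "F \<subseteq> W" "v \<in> P" "c \<in> W" "c \<notin> F"
    and c: "d (par c) < d c" "par c \<in> subtree P v"
    and deep: "\<And>w. w \<in> W \<Longrightarrow> d v < d w \<Longrightarrow> sum m (subtree W w) \<le> r"
    and heavy: "\<And>e. e \<in> W - P \<Longrightarrow> d (par e) < d e \<Longrightarrow> par e \<in> subtree P v \<Longrightarrow>
      sum m (subtree W e) \<le> sum m (subtree W c)"
    and F: "bounded_weight adj m r (insert c F)"
    and full: "subtree W c \<subseteq> insert c F"
    and u: "u \<in> subtree W v" "u \<notin> insert c F"
  shows "bounded_weight adj m r (insert u F)"
proof (rule bounded_weight_insert)
  let ?Q = "subtree P v"
  show "bounded_weight adj m r F" using F bounded_weight_subset by blast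
  fix C assume C: "C \<subseteq> insert u F" "u \<in> C" "linked adj C"
  have CW: "C \<subseteq> W" using C(1) W u(1) subtree_subset by blast
  have finC: "finite C" using CW W(1) finite_subset by blast
  have fin: "finite (subtree W w)" for w using W(1) subtree_subset finite_subset by blast
  have QF: "?Q \<subseteq> F" using subtree_subset W(2) by blast
  then obtain e where e: "e \<in> W - P" "d (par e) < d e" "par e \<in> ?Q" "u \<in> subtree W e"
    using subtree_branch[OF u(1) W(4)] u(2) by blast
  have below: "d v < d w" if "d (par w) < d w" "par w \<in> ?Q" for w
    using subtree_depth[OF that(2)] that(1) by (cases "par w = v") auto
  have Qe: "?Q \<inter> subtree W w = {}" if w: "w \<in> W - P" "d (par w) < d w" "par w \<in> ?Q" for w
  proof -
    have False if q: "q \<in> ?Q" "q \<in> subtree W w" for q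
    proof -
      have "v \<in> subtree W w"
        using subtree_linear[OF q] W w(1) by blast
      then show False using subtree_depth[of v W w] below[OF w(2,3)] by force
    qed
    then show ?thesis by blast
  qed
  have Se: "sum m (subtree W e) \<le> r" using deep e below by blast
  \<comment> \<open>The part of \<open>C\<close> outside the branch at \<open>e\<close> is kept; the
    branch itself is traded for the one at \<open>c\<close>, which is at least as heavy.\<close>
  let ?D = "C - subtree W e"
  have split: "sum m C \<le> sum m (subtree W e) + sum m ?D"
  proof -
    have "sum m C \<le> sum m (subtree W e \<union> ?D)" by (rule sum_mono2) (use fin finC in auto)
    also have "\<dots> = sum m (subtree W e) + sum m ?D"
      by (rule sum.union_disjoint) (use fin finC in auto)
    finally show ?thesis .
  qed
  show "sum m C \<le> r"
  proof (cases "?D = {}")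
    case True
    then have "sum m ?D = 0" by (simp only: sum.empty)
    then show ?thesis using split Se by linarith
  next
    case False
    \<comment> \<open>\<open>C\<close> can leave the branch only through \<open>par e\<close>, so it
      touches the forced part \<open>?Q\<close>, to which the branch at \<open>c\<close> can be
      attached instead.\<close>
    have "u \<in> C \<inter> subtree W e" using C(2) e(4) by blast
    then obtain x y where xy: "x \<in> C \<inter> subtree W e" "y \<in> C" "y \<notin> C \<inter> subtree W e" "adj x y"
      using linked_boundary[OF C(3), of "C \<inter> subtree W e"] False by blast
    then have y: "par e \<in> C" using adj_boundary_subtree[of x W e y] CW by blast
    have "linked adj (C \<union> ?Q)" using linked_Un[OF C(3) linked_subtree] y e(3) by blast
    moreover have "C \<union> ?Q \<subseteq> W" using CW QF W(3) by blast
    ultimately have "linked adj ((C \<union> ?Q) - subtree W e)" by (rule linked_Diff_subtree)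
    moreover have "par c \<in> (C \<union> ?Q) - subtree W e" using Qe[OF e(1,2,3)] c(2) by blast
    moreover have "c \<in> subtree W c" using subtree.root W(5) by blast
    moreover have "adj (par c) c" using c by (simp add: adj_def)
    ultimately have L: "linked adj (((C \<union> ?Q) - subtree W e) \<union> subtree W c)"
      using linked_Un_edge[OF symp_adj] linked_subtree by blast
    have sub: "((C \<union> ?Q) - subtree W e) \<union> subtree W c \<subseteq> insert c F"
      using C(1) e(4) QF full by blast
    \<comment> \<open>Since \<open>c \<notin> C\<close>, meeting the branch at \<open>c\<close>
      would put the top of \<open>C\<close>, and with it \<open>u\<close>, into that branch, which
      lies in \<open>insert c F\<close> by \<open>full\<close>.\<close>
    have disj: "C \<inter> subtree W c = {}"
    proof (rule ccontr)
      assume "C \<inter> subtree W c \<noteq> {}"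
      then obtain z where z: "z \<in> C" "z \<in> subtree W c" by blast
      have "c \<notin> C" using C(1) u(2) W(6) by blast
      then obtain t where "C \<subseteq> subtree W t" "t \<in> subtree W c"
        using linked_avoiding_root[OF C(3) finC CW _ z] by blast
      then have "u \<in> subtree W c" using C(2) subtree_trans by blast
      then show False using full u(2) by blast
    qed
    have "sum m ?D + sum m (subtree W c) = sum m (?D \<union> subtree W c)"
      by (rule sum.union_disjoint[symmetric]) (use fin finC disj in auto)
    also have "\<dots> \<le> sum m (((C \<union> ?Q) - subtree W e) \<union> subtree W c)"
    proof (rule sum_mono2)
      have "insert c F \<subseteq> W" using W by blast
      then show "finite (((C \<union> ?Q) - subtree W e) \<union> subtree W c)"
        by (intro finite_subset[OF sub] finite_subset[OF _ W(1)])
    qed auto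
    also have "\<dots> \<le> r" by (rule bounded_weightD[OF F sub L])
    finally show ?thesis using split heavy[OF e(1,2,3)] by linarith
  qed
qed

theorem vertex_decomposable_forest:
  fixes m :: "'a \<Rightarrow> nat"
  assumes "finite V" "finite P" "V \<inter> P = {}" "bounded_weight adj m r P"
  shows "vertex_decomposable (bounded_faces adj m r V P)"
  using assms
proof (induction "card V" arbitrary: V P rule: less_induct)
  case less
  note finV = less.prems(1) and finP = less.prems(2) and VP = less.prems(3) and bP = less.prems(4)
  let ?W = "V \<union> P"
  have finW: "finite ?W" using finV finP by simp
  have fin: "finite (subtree ?W w)" for w by (rule finite_subset[OF subtree_subset finW])
  have IH: "vertex_decomposable (bounded_faces adj m r (V - {z}) P)"
    "bounded_weight adj m r (insert z P) \<Longrightarrow>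
      vertex_decomposable (bounded_faces adj m r (V - {z}) (insert z P))" if z: "z \<in> V" for z
  proof -
    have "card (V - {z}) < card V" using card_Diff1_less[OF finV z] .
    then show "vertex_decomposable (bounded_faces adj m r (V - {z}) P)"
      "bounded_weight adj m r (insert z P) \<Longrightarrow>
        vertex_decomposable (bounded_faces adj m r (V - {z}) (insert z P))"
      using finV finP VP bP by (auto intro!: less.hyps)
  qed
  show ?case
  proof (cases "bounded_weight adj m r ?W")
    \<comment> \<open>The complex is a simplex, and any free vertex is a cone point.\<close>
    case True
    show ?thesis
    proof (cases "V = {}")
      case True
      then have "bounded_faces adj m r V P = {{}}" using bP by (auto simp: bounded_faces_def)
      then show ?thesis using vertex_decomposable.empty_face by metis
    next
      case False
      then obtain z where z: "z \<in> V" by blast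
      show ?thesis
      proof (rule vertex_decomposable_bounded_faces_cone[OF z IH(1)[OF z]])
        fix F assume "F \<subseteq> V - {z}"
        then have "insert z (F \<union> P) \<subseteq> ?W" using z by blast
        then show "bounded_weight adj m r (insert z (F \<union> P))"
          using bounded_weight_subset[OF True] by blast
      qed
    qed
  next
    case False
    define H where "H = {v \<in> ?W. r < sum m (subtree ?W v)}"
    \<comment> \<open>A connected set that is too heavy lies in the subtree of its top vertex, so
      \<open>H\<close> is nonempty.\<close>
    obtain C where C: "C \<subseteq> ?W" "linked adj C" "r < sum m C"
      using False unfolding bounded_weight_def by (meson not_le)
    then have "C \<noteq> {}" by auto
    then obtain t where t: "t \<in> C" "C = subtree C t"
      using linked_top C(2) finite_subset[OF C(1) finW] by blast
    have "sum m C \<le> sum m (subtree ?W t)"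
      by (rule sum_mono2[OF fin]) (use t subtree_mono[OF C(1), of t] in auto)
    then have "t \<in> H" using C t by (auto simp: H_def)
    moreover have "finite H" using finW by (simp add: H_def)
    ultimately have "\<exists>v\<in>H. \<forall>w\<in>H. d w \<le> d v"
      using finite_has_maximal_value[of H d] \<open>t \<in> H\<close> by blast
    then obtain v where v: "v \<in> ?W" "r < sum m (subtree ?W v)"
      and vmax: "\<And>w. w \<in> H \<Longrightarrow> d w \<le> d v" by (auto simp: H_def)
    have deep: "sum m (subtree ?W w) \<le> r" if "w \<in> ?W" "d v < d w" for w
      using vmax[of w] that by (force simp: H_def)
    \<comment> \<open>Source of the exchange vertices: an admissible set cannot contain a whole
      connected subtree of weight above \<open>r\<close>.\<close>
    have missing: "\<exists>u\<in>subtree ?W v. u \<notin> A" if "bounded_weight adj m r A" for A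
      using bounded_weightD[OF that _ linked_subtree] v(2) by (meson not_le subsetI)
    show ?thesis
    proof (cases "v \<in> V")
      case True
      show ?thesis
      proof (rule vertex_decomposable_bounded_faces_shed[OF True IH[OF True]])
        fix F assume F: "F \<subseteq> V - {v}" "bounded_weight adj m r (insert v (F \<union> P))"
        then obtain u where u: "u \<in> subtree ?W v" "u \<notin> insert v (F \<union> P)" using missing by blast
        have "bounded_weight adj m r (insert u (F \<union> P))"
        proof (rule exchange_forest_vertex[OF finW _ v(1)])
          show "bounded_weight adj m r (F \<union> P)" using F(2) bounded_weight_subset by blast
        qed (use F(1) True VP deep u in auto)
        moreover have "u \<in> V - {v} - F" using u subtree_subset[of ?W v] by blast
        ultimately show "\<exists>u\<in>V - {v} - F. bounded_weight adj m r (insert u (F \<union> P))" by blast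
      qed
    next
      case False
      then have vP: "v \<in> P" using v(1) by blast
      \<comment> \<open>Roots of the branches hanging from the forced part. There are some, because
        the forced vertices alone are admissible and so miss part of the heavy subtree.\<close>
      define U where "U = {c \<in> V. d (par c) < d c \<and> par c \<in> subtree P v}"
      have branch: "\<exists>c\<in>U. u \<in> subtree ?W c" if "u \<in> subtree ?W v" "u \<notin> P" for u
        using subtree_branch[OF that(1) vP] that(2) subtree_subset[of P v] by (auto simp: U_def)
      have "U \<noteq> {}" using missing[OF bP] branch by blast
      moreover have "finite U" using finV by (simp add: U_def)
      ultimately have "\<exists>c\<in>U. \<forall>e\<in>U. sum m (subtree ?W e) \<le> sum m (subtree ?W c)"
        using finite_has_maximal_value[of U "\<lambda>c. sum m (subtree ?W c)"] by blast
      then obtain c where c: "c \<in> V" "d (par c) < d c" "par c \<in> subtree P v"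
        and cmax: "\<And>e. e \<in> U \<Longrightarrow> sum m (subtree ?W e) \<le> sum m (subtree ?W c)"
        by (auto simp: U_def)
      have dc: "d v < d c" using subtree_depth[OF c(3)] c(2) by (cases "par c = v") auto
      have cv: "c \<in> subtree ?W v"
        using subtree.child[OF _ c(2)] c(1,3) subtree_mono[of P ?W v] by blast
      show ?thesis
      proof (rule vertex_decomposable_bounded_faces_shed[OF c(1) IH[OF c(1)]])
        fix F assume F: "F \<subseteq> V - {c}" "bounded_weight adj m r (insert c (F \<union> P))"
        have cF: "c \<notin> F \<union> P" using F(1) c(1) VP by blast
        have FW: "F \<union> P \<subseteq> ?W" using F(1) by blast
        \<comment> \<open>If the branch at \<open>c\<close> has a missing vertex, the exchange takes
          place inside it, with \<open>c\<close> in the role of \<open>v\<close>; only for a full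
          branch is another branch used.\<close>
        have "\<exists>u\<in>subtree ?W v. u \<notin> insert c (F \<union> P) \<and> bounded_weight adj m r (insert u (F \<union> P))"
        proof (cases "subtree ?W c \<subseteq> insert c (F \<union> P)")
          case True
          obtain u where u: "u \<in> subtree ?W v" "u \<notin> insert c (F \<union> P)" using missing[OF F(2)] by blast
          have "bounded_weight adj m r (insert u (F \<union> P))"
          proof (rule exchange_forest_branch[OF finW _ FW vP _ cF c(2,3) deep _ F(2) True u])
            fix e assume "e \<in> ?W - P" "d (par e) < d e" "par e \<in> subtree P v"
            then show "sum m (subtree ?W e) \<le> sum m (subtree ?W c)" by (intro cmax) (auto simp: U_def)
          qed (use c(1) in auto)
          then show ?thesis using u by blast
        next
          case False
          then obtain u where u: "u \<in> subtree ?W c" "u \<notin> insert c (F \<union> P)" by blast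
          have "bounded_weight adj m r (insert u (F \<union> P))"
          proof (rule exchange_forest_vertex[OF finW FW _ cF])
            show "bounded_weight adj m r (F \<union> P)" using F(2) bounded_weight_subset by blast
            show "sum m (subtree ?W w) \<le> r" if "w \<in> ?W" "d c < d w" for w using deep that dc by simp
          qed (use c(1) u in auto)
          then show ?thesis using u subtree_trans[OF u(1) cv] by blast
        qed
        then show "\<exists>u\<in>V - {c} - F. bounded_weight adj m r (insert u (F \<union> P))"
          using subtree_subset[of ?W v] by blast
      qed
    qed
  qed
qed

end

section \<open>Block graphs and pendant clusters\<close>

definition one_weight :: "'a \<Rightarrow> nat" where
  "one_weight v = 1"

lemma sum_one_weight [simp]: "sum one_weight C = card C"
  by (simp add: one_weight_def)

text \<open>A block graph is turned into a forest by adding a forced vertex \<open>Inr i\<close> of weight \<open>0\<close> for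
  each clique \<open>Q i\<close>.  Here \<open>home v\<close> is the clique in which \<open>v\<close> is not the top vertex, and
  \<open>p i\<close> is the top vertex of \<open>Q i\<close>; if \<open>p i\<close> is not less deep than \<open>i\<close>, then \<open>Q i\<close> has none and
  is a root.\<close>

locale rooted_cliques =
  fixes E :: "'a \<Rightarrow> 'a \<Rightarrow> bool" and U :: "'a set" and I :: "'i set" and Q :: "'i \<Rightarrow> 'a set"
    and home :: "'a \<Rightarrow> 'i" and p :: "'i \<Rightarrow> 'a" and dv :: "'a \<Rightarrow> nat" and di :: "'i \<Rightarrow> nat"
  assumes finite_U: "finite U" and finite_I: "finite I"
    and adj_iff: "\<And>u v. u \<in> U \<Longrightarrow> v \<in> U \<Longrightarrow> E u v \<longleftrightarrow> u \<noteq> v \<and> (\<exists>i\<in>I. u \<in> Q i \<and> v \<in> Q i)"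
    and mem_iff: "\<And>v i. v \<in> U \<Longrightarrow> i \<in> I \<Longrightarrow> v \<in> Q i \<longleftrightarrow> home v = i \<or> (p i = v \<and> dv v < di i)"
    and home_depth: "\<And>v. v \<in> U \<Longrightarrow> di (home v) < dv v"
begin

definition par :: "'a + 'i \<Rightarrow> 'a + 'i" where
  "par = case_sum (\<lambda>v. Inr (home v)) (\<lambda>i. Inl (p i))"

sublocale tree: depth_forest par "case_sum dv di" .

definition wt :: "'a + 'i \<Rightarrow> nat" where
  "wt = case_sum one_weight (\<lambda>_. 0)"

lemma tree_adj:
  assumes "v \<in> U" "i \<in> I"
  shows "tree.adj (Inl v) (Inr i) \<longleftrightarrow> v \<in> Q i" "tree.adj (Inr i) (Inl v) \<longleftrightarrow> v \<in> Q i"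
  using mem_iff[OF assms] home_depth[OF assms(1)]
  unfolding tree.adj_def unfolding par_def by auto

lemma tree_not_adj: "\<not> tree.adj (Inl v) (Inl w)" "\<not> tree.adj (Inr i) (Inr j)"
  unfolding tree.adj_def unfolding par_def by auto

lemma sum_wt:
  assumes "finite C"
  shows "sum wt C = card {v. Inl v \<in> C}"
proof -
  have "sum wt C = sum wt (Inl ` {v. Inl v \<in> C})"
  proof (rule sum.mono_neutral_right[OF assms])
    show "\<forall>x\<in>C - Inl ` {v. Inl v \<in> C}. wt x = 0" by (auto simp: wt_def split: sum.split)
  qed auto
  also have "\<dots> = card {v. Inl v \<in> C}" by (subst sum.reindex) (auto simp: wt_def one_weight_def)
  finally show ?thesis .
qed

text \<open>Connected sets correspond: add to \<open>C\<close> the clique vertices whose cliques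
  meet it, or drop all clique vertices from \<open>C'\<close>. These have weight \<open>0\<close>,
  so the weights agree.\<close>

lemma bounded_tree_iff:
  assumes F: "F \<subseteq> U"
  shows "bounded_weight tree.adj wt r (Inl ` F \<union> Inr ` I) \<longleftrightarrow> bounded_weight E one_weight r F"
proof
  assume b: "bounded_weight tree.adj wt r (Inl ` F \<union> Inr ` I)"
  show "bounded_weight E one_weight r F"
    unfolding bounded_weight_def
  proof (intro allI impI)
    fix C assume C: "C \<subseteq> F" "linked E C"
    define C' where "C' = Inl ` C \<union> Inr ` {i \<in> I. Q i \<inter> C \<noteq> {}}"
    have CU: "C \<subseteq> U" using C F by blast
    have "linked tree.adj C'"
    proof (rule linkedI)
      fix X assume X: "X \<subseteq> C'" "X \<noteq> {}"
        and cl: "\<And>x y. x \<in> X \<Longrightarrow> y \<in> C' \<Longrightarrow> tree.adj x y \<Longrightarrow> y \<in> X"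
      have up: "Inr i \<in> X" if "Inl v \<in> X" "v \<in> Q i" "i \<in> I" for v i
      proof -
        have "v \<in> C" using that(1) X(1) by (auto simp: C'_def)
        then show ?thesis using cl[OF that(1), of "Inr i"] that CU tree_adj(1) by (auto simp: C'_def)
      qed
      have down: "Inl v \<in> X" if "Inr i \<in> X" "v \<in> Q i" "v \<in> C" for v i
      proof -
        have "i \<in> I" using that(1) X(1) by (auto simp: C'_def)
        then show ?thesis using cl[OF that(1), of "Inl v"] that CU tree_adj(2) by (auto simp: C'_def)
      qed
      have "{v. Inl v \<in> X} = C"
      proof (rule linkedD[OF C(2)])
        show "{v. Inl v \<in> X} \<subseteq> C" using X(1) by (auto simp: C'_def)
        obtain x where x: "x \<in> X" using X(2) by blast
        then have "x \<in> C'" using X(1) by blast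
        then show "{v. Inl v \<in> X} \<noteq> {}" using down x by (auto simp: C'_def)
        fix v w assume vw: "v \<in> {v. Inl v \<in> X}" "w \<in> C" "E v w"
        then have "v \<in> C" using X(1) by (auto simp: C'_def)
        then obtain i where "i \<in> I" "v \<in> Q i" "w \<in> Q i" using adj_iff vw CU by blast
        then show "w \<in> {v. Inl v \<in> X}" using up down vw by blast
      qed
      then show "C' \<subseteq> X" using up by (auto simp: C'_def)
    qed
    moreover have "C' \<subseteq> Inl ` F \<union> Inr ` I" using C(1) by (auto simp: C'_def)
    ultimately have "sum wt C' \<le> r" using bounded_weightD[OF b] by blast
    moreover have "finite C'" using finite_subset[OF CU finite_U] finite_I by (simp add: C'_def)
    moreover have "{v. Inl v \<in> C'} = C" by (auto simp: C'_def)
    ultimately show "sum one_weight C \<le> r" by (simp add: sum_wt)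
  qed
next
  assume b: "bounded_weight E one_weight r F"
  show "bounded_weight tree.adj wt r (Inl ` F \<union> Inr ` I)"
    unfolding bounded_weight_def
  proof (intro allI impI)
    fix C' assume C': "C' \<subseteq> Inl ` F \<union> Inr ` I" "linked tree.adj C'"
    define C where "C = {v. Inl v \<in> C'}"
    have CF: "C \<subseteq> F" using C'(1) by (auto simp: C_def)
    have CI: "i \<in> I" if "Inr i \<in> C'" for i using C'(1) that by auto
    \<comment> \<open>Passing through a clique vertex can be replaced by an edge, since distinct
      vertices of one clique are adjacent.\<close>
    have "linked E C"
    proof (rule linkedI)
      fix X assume X: "X \<subseteq> C" "X \<noteq> {}"
        and cl: "\<And>x y. x \<in> X \<Longrightarrow> y \<in> C \<Longrightarrow> E x y \<Longrightarrow> y \<in> X"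
      define X' where "X' = Inl ` X \<union> Inr ` {i. Inr i \<in> C' \<and> Q i \<inter> X \<noteq> {}}"
      have "X' = C'"
      proof (rule linkedD[OF C'(2)])
        show "X' \<subseteq> C'" "X' \<noteq> {}" using X by (auto simp: X'_def C_def)
        fix x y assume xy: "x \<in> X'" "y \<in> C'" "tree.adj x y"
        show "y \<in> X'"
        proof (cases y)
          case (Inl w)
          then have w: "w \<in> C" "w \<in> U" using xy(2) CF F by (auto simp: C_def)
          show ?thesis
          proof (cases x)
            case (Inl v)
            then show ?thesis using xy(3) \<open>y = Inl w\<close> tree_not_adj by simp
          next
            case (Inr i)
            then obtain v where v: "Inr i \<in> C'" "v \<in> Q i" "v \<in> X" using xy(1) by (auto simp: X'_def)
            then have i: "i \<in> I" using CI by blast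
            then have wQ: "w \<in> Q i" using tree_adj(2)[OF w(2) i] xy(3) Inl Inr by simp
            have "w \<in> X"
            proof (cases "v = w")
              case False
              then have "E v w" using adj_iff[of v w] v X(1) CF F w(2) wQ i by blast
              then show ?thesis using cl v(3) w(1) by blast
            qed (use v in simp)
            then show ?thesis using Inl by (simp add: X'_def)
          qed
        next
          case (Inr i)
          then have i: "i \<in> I" using CI xy(2) by blast
          show ?thesis
          proof (cases x)
            case (Inl v)
            then have v: "v \<in> X" using xy(1) by (auto simp: X'_def)
            then have "v \<in> Q i" using tree_adj(1)[of v i] i xy(3) Inl Inr X(1) CF F by auto
            then show ?thesis using v Inr xy(2) by (auto simp: X'_def)
          next
            case (Inr j)
            then show ?thesis using xy(3) \<open>y = Inr i\<close> tree_not_adj by simp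
          qed
        qed
      qed
      then show "C \<subseteq> X" by (auto simp: X'_def C_def)
    qed
    then have "card C \<le> r" using bounded_weightD[OF b CF] by simp
    moreover have "finite C'"
      using finite_subset[OF C'(1)] finite_subset[OF F finite_U] finite_I by blast
    ultimately show "sum wt C' \<le> r" by (simp add: sum_wt C_def)
  qed
qed

text \<open>Only the vertices of \<open>R\<close> are free in the forest, so that all induced
  subgraphs are covered. The clique vertices alone are admissible.\<close>

theorem vertex_decomposable_rooted_cliques:
  assumes R: "R \<subseteq> U"
  shows "vertex_decomposable (bounded_faces E one_weight r R {})"
proof -
  let ?K = "bounded_faces tree.adj wt r (Inl ` R) (Inr ` I)"
  have iff: "Inl ` F \<in> ?K \<longleftrightarrow> F \<in> bounded_faces E one_weight r R {}" if "F \<subseteq> R" for F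
    using bounded_tree_iff[of F r] that R by (auto simp: bounded_faces_def)
  have "bounded_weight E one_weight r {}" by (simp add: bounded_weight_def)
  then have "bounded_weight tree.adj wt r (Inr ` I)" using bounded_tree_iff[of "{}"] by simp
  then have "vertex_decomposable ?K"
    using finite_subset[OF R finite_U] finite_I by (intro tree.vertex_decomposable_forest) auto
  then have "vertex_decomposable ((`) projl ` ?K)"
  proof (rule vertex_decomposable_image)
    have "\<Union>?K \<subseteq> Inl ` R" by (auto simp: bounded_faces_def)
    then show "inj_on projl (\<Union>?K)" by (rule inj_on_subset[rotated]) (auto simp: inj_on_def)
  qed
  also have "(`) projl ` ?K = bounded_faces E one_weight r R {}"
  proof (intro subset_antisym subsetI)
    fix F assume "F \<in> (`) projl ` ?K"
    then obtain F' where F': "F' \<in> ?K" "F = projl ` F'" by blast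
    then have "F' \<subseteq> Inl ` R" by (auto simp: bounded_faces_def)
    then obtain F'' where F'': "F' = Inl ` F''" "F'' \<subseteq> R" by (meson subset_imageE)
    then have "F = F''" using F'(2) by (simp add: image_image)
    then show "F \<in> bounded_faces E one_weight r R {}" using iff F'' F'(1) by blast
  next
    fix F assume F: "F \<in> bounded_faces E one_weight r R {}"
    then have "Inl ` F \<in> ?K" using iff[of F] by (auto simp: bounded_faces_def)
    moreover have "F = projl ` (Inl ` F :: ('a + 'i) set)" by (simp add: image_image)
    ultimately show "F \<in> (`) projl ` ?K" by blast
  qed
  finally show ?thesis .
qed

end

section \<open>Clusters attached at a single vertex\<close>

text \<open>Abstracts a star without its centre \<open>a\<close>: a set of neighbours of
  \<open>a\<close> with no other neighbours outside itself.\<close>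

locale pendant_cluster =
  fixes E :: "'a \<Rightarrow> 'a \<Rightarrow> bool" and V :: "'a set" and a :: 'a and Z\<^sub>0 :: "'a set"
  assumes symp_E: "symp E" and finite_V: "finite V" and a: "a \<in> V" "a \<notin> Z\<^sub>0"
    and Z0: "Z\<^sub>0 \<subseteq> V" "\<And>z. z \<in> Z\<^sub>0 \<Longrightarrow> E a z"
    and pendant: "\<And>z w. z \<in> Z\<^sub>0 \<Longrightarrow> w \<in> V \<Longrightarrow> E z w \<Longrightarrow> w = a \<or> w \<in> Z\<^sub>0"
begin

lemma linked_Un_cluster:
  assumes "linked E P" "a \<in> P" "Z \<subseteq> Z\<^sub>0"
  shows "linked E (P \<union> Z)"
proof (rule linkedI_base[OF symp_E, of a])
  fix X assume X: "X \<subseteq> P \<union> Z" "a \<in> X" "\<And>x y. x \<in> X \<Longrightarrow> y \<in> P \<union> Z \<Longrightarrow> E x y \<Longrightarrow> y \<in> X"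
  have "X \<inter> P = P" by (rule linkedD[OF assms(1)]) (use X assms(2) in blast)+
  moreover have "Z \<subseteq> X" using X(2,3) assms(3) Z0(2) by blast
  ultimately show "P \<union> Z \<subseteq> X" by blast
qed (use assms in simp)

lemma linked_within:
  assumes "linked E C" "C \<subseteq> V" "Y \<inter> C \<noteq> {}"
    and "\<And>x y. x \<in> Y \<inter> C \<Longrightarrow> y \<in> C \<Longrightarrow> E x y \<Longrightarrow> y \<in> Y"
  shows "C \<subseteq> Y"
proof -
  have "Y \<inter> C = C" by (rule linkedD[OF assms(1)]) (use assms(3,4) in blast)+
  then show ?thesis by blast
qed

text \<open>Every neighbour of \<open>w\<close> in \<open>C\<close> is \<open>a\<close> or adjacent
  to \<open>a\<close>, so \<open>w\<close> is not a cut vertex.\<close>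

lemma linked_Diff_pendant:
  assumes "linked E C" "a \<in> C" "C \<subseteq> V" "w \<in> Z\<^sub>0"
  shows "linked E (C - {w})"
proof (rule linkedI_base[OF symp_E, of a])
  fix X assume X: "X \<subseteq> C - {w}" "a \<in> X" "\<And>x y. x \<in> X \<Longrightarrow> y \<in> C - {w} \<Longrightarrow> E x y \<Longrightarrow> y \<in> X"
  have "C \<subseteq> insert w X"
  proof (rule linked_within[OF assms(1,3)])
    show "insert w X \<inter> C \<noteq> {}" using X(2) assms(2) by blast
    fix x y assume xy: "x \<in> insert w X \<inter> C" "y \<in> C" "E x y"
    show "y \<in> insert w X"
    proof (cases "x \<in> X")
      case True
      then show ?thesis using X(3) xy by blast
    next
      case False
      then have "y = a \<or> y \<in> Z\<^sub>0" using pendant[OF assms(4), of y] xy assms(3) by blast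
      then show ?thesis using X(2,3) Z0(2) xy(2) by blast
    qed
  qed
  then show "C - {w} \<subseteq> X" by blast
qed (use assms a in blast)

text \<open>A connected \<open>C\<close> through \<open>w\<close> is enlarged to
  \<open>C \<union> P \<union> {u}\<close>. Removing \<open>w\<close> keeps it connected and puts it
  into the admissible set; since \<open>u \<notin> C\<close> makes up for the lost \<open>w\<close>,
  \<open>C\<close> has at most \<open>r\<close> vertices.\<close>

lemma exchange_cluster:
  assumes P: "linked E P" "a \<in> P" "P \<subseteq> V" and F: "F \<subseteq> V" and x: "x \<in> P" "E x u" "u \<in> V" "u \<notin> F \<union> P"
    and w: "w \<in> Z\<^sub>0" "w \<noteq> u" "w \<notin> F \<union> P"
    and b: "bounded_weight E one_weight r (insert u (F \<union> P))"
  shows "bounded_weight E one_weight r (insert w (F \<union> P))"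
proof (rule bounded_weight_insert)
  show "bounded_weight E one_weight r (F \<union> P)" using b bounded_weight_subset by blast
  fix C assume C: "C \<subseteq> insert w (F \<union> P)" "w \<in> C" "linked E C"
  have wV: "w \<in> V" using w Z0 by blast
  let ?D = "insert u (C \<union> P)"
  have DV: "?D \<subseteq> V" using C P F x(3) wV by blast
  have "linked E (P \<union> C)"
    using linked_Un_edge[OF symp_E P(1) C(3) P(2) C(2)] Z0(2) w(1) by blast
  then have "linked E ((P \<union> C) \<union> {u})"
    using linked_Un_edge[OF symp_E _ linked_singleton] x(1,2) by blast
  then have "linked E (?D - {w})"
    using P(2) DV w(1) by (intro linked_Diff_pendant) (simp_all add: Un_commute)
  moreover have "?D - {w} \<subseteq> insert u (F \<union> P)" using C by blast
  ultimately have "card (?D - {w}) \<le> r" using bounded_weightD[OF b] by fastforce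
  moreover have fin: "finite ?D" by (rule finite_subset[OF DV finite_V])
  moreover have "card (insert u C) \<le> card ?D" using fin by (intro card_mono) auto
  moreover have "card (insert u C) = Suc (card C)"
    using fin C(1) w(2) x(4) by (subst card_insert_disjoint) auto
  moreover have "card (?D - {w}) = card ?D - 1" using C(2) by simp
  ultimately show "sum one_weight C \<le> r" by simp
qed

text \<open>\<open>P\<close> is the forced component of \<open>a\<close>, \<open>Z\<close> holds
  free cluster vertices and \<open>R\<close> the other free vertices. The invariant
  \<open>large\<close> says that \<open>P \<union> Z\<close> is too big to be admissible or that
  \<open>P\<close> is cut off from \<open>R\<close>.\<close>

lemma vertex_decomposable_forced_center:
  assumes rest: "\<And>R'. R' \<subseteq> R \<Longrightarrow> vertex_decomposable (bounded_faces E one_weight r R' {})"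
    and P: "linked E P" "a \<in> P" "P \<subseteq> V" "card P \<le> r"
    and R: "R \<subseteq> V" "R \<inter> Z\<^sub>0 = {}" "R \<inter> P = {}" and Z: "Z \<subseteq> Z\<^sub>0" "Z \<inter> P = {}"
    and large: "r < card P + card Z \<or> (\<forall>x\<in>P. \<forall>y\<in>R. \<not> E x y)"
  shows "vertex_decomposable (bounded_faces E one_weight r (R \<union> Z) P)"
  using assms
proof (induction "card (R \<union> Z)" arbitrary: R Z P rule: less_induct)
  case less
  note rest = less.prems(1) and P = less.prems(2-5) and R = less.prems(6-8) and Z = less.prems(9,10)
    and large = less.prems(11)
  have ZV: "Z \<subseteq> V" using Z Z0 by blast
  have fin: "finite R" "finite Z" "finite P" using R ZV P finite_V finite_subset by blast+
  have RZ: "R \<inter> Z = {}" using R Z by blast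
  have smaller: "card (X - {z}) < card (R \<union> Z)" if "X = R \<union> Z" "z \<in> X" for X z
    using card_Diff1_less[of X z] fin that by blast
  have bP: "bounded_weight E one_weight r P"
    unfolding bounded_weight_def using P(4) card_mono[OF fin(3)] by (auto intro: order_trans)
  show ?case
  proof (cases "\<exists>x\<in>P. \<exists>u\<in>R. E x u")
    case True
    then obtain x u where xu: "x \<in> P" "u \<in> R" "E x u" by blast
    then have lg: "r < card P + card Z" using large by blast
    have eq: "(R \<union> Z) - {u} = (R - {u}) \<union> Z" using xu RZ by blast
    have rest': "vertex_decomposable (bounded_faces E one_weight r R' {})" if "R' \<subseteq> R - {u}" for R'
      using rest[of R'] that by blast
    have side: "R - {u} \<subseteq> V" "(R - {u}) \<inter> Z\<^sub>0 = {}" "(R - {u}) \<inter> P = {}" using R by blast+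
    have sm: "card ((R - {u}) \<union> Z) < card (R \<union> Z)" using smaller[of "R \<union> Z" u] xu eq by simp
    show ?thesis
    proof (rule vertex_decomposable_bounded_faces_shed[of u])
      show "u \<in> R \<union> Z" using xu by blast
      show "vertex_decomposable (bounded_faces E one_weight r (R \<union> Z - {u}) P)"
        unfolding eq by (rule less.hyps[OF sm _ P side Z]) (erule rest', use lg in simp)
      show "vertex_decomposable (bounded_faces E one_weight r (R \<union> Z - {u}) (insert u P))"
        if b: "bounded_weight E one_weight r (insert u P)"
      proof -
        have l: "linked E (insert u P)"
          using linked_Un_edge[OF symp_E P(1) linked_singleton xu(1) _ xu(3)] by simp
        then have c: "card (insert u P) \<le> r" using bounded_weightD[OF b subset_refl] by simp
        have "card P \<le> card (insert u P)" using fin by (intro card_mono) auto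
        then have lg': "r < card (insert u P) + card Z" using lg by linarith
        have side': "a \<in> insert u P" "insert u P \<subseteq> V" "(R - {u}) \<inter> insert u P = {}" "Z \<inter> insert u P = {}"
          using P R Z xu RZ by blast+
        show ?thesis
          unfolding eq
          by (rule less.hyps[OF sm _ l side'(1,2) c side(1,2) side'(3) Z(1) side'(4)])
            (erule rest', use lg' in simp)
      qed
      fix F assume F: "F \<subseteq> R \<union> Z - {u}" "bounded_weight E one_weight r (insert u (F \<union> P))"
      \<comment> \<open>Otherwise the admissible set would contain the connected set
        \<open>P \<union> Z\<close> of more than \<open>r\<close> vertices.\<close>
      have "\<exists>w\<in>Z. w \<notin> F"
      proof (rule ccontr)
        assume "\<not> (\<exists>w\<in>Z. w \<notin> F)"
        then have "P \<union> Z \<subseteq> insert u (F \<union> P)" by blast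
        then have "card (P \<union> Z) \<le> r"
          using bounded_weightD[OF F(2) _ linked_Un_cluster[OF P(1,2) Z(1)]] by simp
        moreover have "card (P \<union> Z) = card P + card Z"
          using fin Z(2) by (intro card_Un_disjoint) auto
        ultimately show False using lg by simp
      qed
      then obtain w where w: "w \<in> Z" "w \<notin> F" by blast
      have "bounded_weight E one_weight r (insert w (F \<union> P))"
        by (rule exchange_cluster[OF P(1-3) _ xu(1,3) _ _ _ _ _ F(2)])
          (use F(1) R ZV Z RZ xu(2) w in blast)+
      then show "\<exists>w\<in>R \<union> Z - {u} - F. bounded_weight E one_weight r (insert w (F \<union> P))"
        using w RZ xu(2) by blast
    qed
  next
    case False
    \<comment> \<open>\<open>R\<close> cannot be reached any more: not from \<open>P\<close> by the
      case assumption, and not from \<open>Z\<close>, whose neighbours are \<open>a\<close> and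
      cluster vertices.\<close>
    have within: "C \<subseteq> P \<union> Z" if C: "linked E C" "C \<subseteq> R \<union> Z \<union> P" "C \<inter> (P \<union> Z) \<noteq> {}" for C
    proof (rule linked_within[OF C(1)])
      show "C \<subseteq> V" using C(2) R ZV P by blast
      show "(P \<union> Z) \<inter> C \<noteq> {}" using C(3) by blast
      fix x y assume xy: "x \<in> (P \<union> Z) \<inter> C" "y \<in> C" "E x y"
      have "y \<notin> R"
      proof
        assume y: "y \<in> R"
        then have "x \<in> Z" using False xy by blast
        then have "y = a \<or> y \<in> Z\<^sub>0" using pendant xy(3) y R(1) Z(1) by blast
        then show False using y R P(2) by blast
      qed
      then show "y \<in> P \<union> Z" using xy(2) C(2) by blast
    qed
    show ?thesis
    proof (cases "Z = {}")
      \<comment> \<open>With \<open>Z\<close> used up, \<open>P\<close> is a separate component of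
        admissible size, and only the complex on \<open>R\<close> remains.\<close>
      case True
      have "bounded_weight E one_weight r (F \<union> P) \<longleftrightarrow> bounded_weight E one_weight r F"
        if F: "F \<subseteq> R" for F
      proof
        assume b: "bounded_weight E one_weight r F"
        show "bounded_weight E one_weight r (F \<union> P)"
          unfolding bounded_weight_def
        proof (intro allI impI)
          fix C assume C: "C \<subseteq> F \<union> P" "linked E C"
          show "sum one_weight C \<le> r"
          proof (cases "C \<inter> P = {}")
            case True
            then show ?thesis using bounded_weightD[OF b] C by blast
          next
            case False
            then have "C \<subseteq> P" using within[OF C(2)] C(1) F \<open>Z = {}\<close> by blast
            then show ?thesis using bounded_weightD[OF bP _ C(2)] by blast
          qed
        qed
      qed (auto elim: bounded_weight_subset)
      then have "bounded_faces E one_weight r (R \<union> Z) P = bounded_faces E one_weight r R {}"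
        using True by (auto simp: bounded_faces_def)
      then show ?thesis using rest by simp
    next
      case Zne: False
      then obtain z where z: "z \<in> Z" by blast
      have eq: "(R \<union> Z) - {z} = R \<union> (Z - {z})" using z RZ by blast
      have sm: "card (R \<union> (Z - {z})) < card (R \<union> Z)" using smaller[of "R \<union> Z" z] z eq by simp
      \<comment> \<open>Shrinking \<open>Z\<close> may destroy the first alternative of
        \<open>large\<close>, but the second one holds by now.\<close>
      have del: "vertex_decomposable (bounded_faces E one_weight r (R \<union> Z - {z}) P)"
        unfolding eq
        by (rule less.hyps[OF sm _ P R]) (erule rest, use Z False in \<open>blast+\<close>)
      have bound: "bounded_weight E one_weight r (insert w (F \<union> P))"
        if F: "F \<subseteq> R \<union> Z" "bounded_weight E one_weight r (F \<union> P)" "w \<in> Z"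
          "card (insert w (P \<union> (F \<inter> Z))) \<le> r" for F w
      proof (rule bounded_weight_insert[OF F(2)])
        fix C assume C: "C \<subseteq> insert w (F \<union> P)" "w \<in> C" "linked E C"
        then have "C \<subseteq> P \<union> Z" using within[OF C(3)] F(1,3) by blast
        then have "C \<subseteq> insert w (P \<union> (F \<inter> Z))" using C(1) by blast
        then have "card C \<le> card (insert w (P \<union> (F \<inter> Z)))" using fin by (intro card_mono) auto
        then show "sum one_weight C \<le> r" using F(4) by simp
      qed
      show ?thesis
      proof (cases "card (P \<union> Z) \<le> r")
        \<comment> \<open>All of \<open>P \<union> Z\<close> fits, so \<open>z\<close> is a cone
          point.\<close>
        case True
        show ?thesis
        proof (rule vertex_decomposable_bounded_faces_cone[OF _ del])
          show "z \<in> R \<union> Z" using z by blast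
          fix F assume F: "F \<subseteq> R \<union> Z - {z}" "bounded_weight E one_weight r (F \<union> P)"
          have "card (insert z (P \<union> (F \<inter> Z))) \<le> card (P \<union> Z)"
            using fin z by (intro card_mono) auto
          then show "bounded_weight E one_weight r (insert z (F \<union> P))"
            using bound[OF _ F(2) z] F(1) True by fastforce
        qed
      next
        \<comment> \<open>A face of the link of \<open>z\<close> misses another vertex
          \<open>w\<close> of \<open>Z\<close>; trading \<open>z\<close> for \<open>w\<close> does
          not increase the count in \<open>P \<union> Z\<close>.\<close>
        case big: False
        show ?thesis
        proof (rule vertex_decomposable_bounded_faces_shed[OF _ del])
          show "z \<in> R \<union> Z" using z by blast
          show "vertex_decomposable (bounded_faces E one_weight r (R \<union> Z - {z}) (insert z P))"
            if b: "bounded_weight E one_weight r (insert z P)"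
          proof -
            have l: "linked E (insert z P)"
              using linked_Un_cluster[OF P(1,2), of "{z}"] subsetD[OF Z(1) z] by simp
            then have c: "card (insert z P) \<le> r" using bounded_weightD[OF b subset_refl] by simp
            have "\<not> E x y" if "x \<in> insert z P" "y \<in> R" for x y
            proof
              assume "E x y"
              then have "x = z" using that False by blast
              then have "y = a \<or> y \<in> Z\<^sub>0" using pendant \<open>E x y\<close> that(2) R(1) Z(1) z by blast
              then show False using that(2) R P(2) by blast
            qed
            then have far: "\<forall>x\<in>insert z P. \<forall>y\<in>R. \<not> E x y" by blast
            have "a \<in> insert z P" "insert z P \<subseteq> V" "R \<inter> insert z P = {}" "Z - {z} \<subseteq> Z\<^sub>0"
              "(Z - {z}) \<inter> insert z P = {}" using P R Z z ZV RZ by blast+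
            note side = this
            show ?thesis
              unfolding eq
              by (rule less.hyps[OF sm _ l side(1,2) c R(1,2) side(3,4,5)])
                (erule rest, use far in blast)
          qed
          fix F assume F: "F \<subseteq> R \<union> Z - {z}" "bounded_weight E one_weight r (insert z (F \<union> P))"
          have "insert z (F \<inter> Z) \<subseteq> Z\<^sub>0" using z Z(1) by blast
          then have "linked E (P \<union> insert z (F \<inter> Z))" by (rule linked_Un_cluster[OF P(1,2)])
          moreover have "P \<union> insert z (F \<inter> Z) \<subseteq> insert z (F \<union> P)" by blast
          ultimately have c: "card (P \<union> insert z (F \<inter> Z)) \<le> r"
            using bounded_weightD[OF F(2)] by fastforce
          have "P \<union> insert z (F \<inter> Z) \<noteq> P \<union> Z" using c big by metis
          then obtain w where w: "w \<in> Z" "w \<notin> F" "w \<noteq> z" using z by blast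
          have "card (insert w (P \<union> (F \<inter> Z))) \<le> Suc (card (P \<union> (F \<inter> Z)))"
            using fin by (simp add: card_insert_if)
          also have "\<dots> = card (insert z (P \<union> (F \<inter> Z)))"
            using fin z Z(2) F(1) by (subst card_insert_disjoint) auto
          also have "\<dots> \<le> r" using c by simp
          finally have "bounded_weight E one_weight r (insert w (F \<union> P))"
            using bound[OF _ _ w(1)] F bounded_weight_subset[OF F(2), of "F \<union> P"] by blast
          then show "\<exists>w\<in>R \<union> Z - {z} - F. bounded_weight E one_weight r (insert w (F \<union> P))"
            using w by blast
        qed
      qed
    qed
  qed
qed

text \<open>The link of \<open>a\<close> is the case \<open>P = {a}\<close>,
  \<open>Z = Z\<^sub>0\<close>, where \<open>r \<le> card Z\<^sub>0\<close> gives the first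
  alternative of \<open>large\<close>. For shedding, a face of the link has at most
  \<open>r - 1\<close> cluster vertices, as they are connected through \<open>a\<close>; a missing
  one can be added, because without \<open>a\<close> its component stays in the cluster.\<close>

theorem vertex_decomposable_large_cluster:
  assumes "1 \<le> r" "r \<le> card Z\<^sub>0"
    and rest: "\<And>R. R \<subseteq> V - {a} \<Longrightarrow> vertex_decomposable (bounded_faces E one_weight r R {})"
  shows "vertex_decomposable (bounded_faces E one_weight r V {})"
proof (rule vertex_decomposable_bounded_faces_shed[OF a(1)])
  have fin: "finite Z\<^sub>0" using Z0 finite_V finite_subset by blast
  show "vertex_decomposable (bounded_faces E one_weight r (V - {a}) {})" using rest by blast
  have "vertex_decomposable (bounded_faces E one_weight r ((V - {a} - Z\<^sub>0) \<union> Z\<^sub>0) {a})"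
  proof (rule vertex_decomposable_forced_center)
    show "vertex_decomposable (bounded_faces E one_weight r R' {})" if "R' \<subseteq> V - {a} - Z\<^sub>0" for R'
      using rest that by blast
    show "linked E {a}" by (rule linked_singleton)
  qed (use assms(1,2) a in auto)
  moreover have "(V - {a} - Z\<^sub>0) \<union> Z\<^sub>0 = V - {a}" using Z0(1) a(2) by blast
  ultimately show "vertex_decomposable (bounded_faces E one_weight r (V - {a}) {a})" by simp
  fix F assume F: "F \<subseteq> V - {a}" "bounded_weight E one_weight r (insert a (F \<union> {}))"
  have "linked E ({a} \<union> (F \<inter> Z\<^sub>0))" by (rule linked_Un_cluster[OF linked_singleton]) auto
  then have "card (insert a (F \<inter> Z\<^sub>0)) \<le> r"
    using bounded_weightD[OF F(2), of "insert a (F \<inter> Z\<^sub>0)"] by auto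
  then have c: "Suc (card (F \<inter> Z\<^sub>0)) \<le> r" using fin a(2) by simp
  have "F \<inter> Z\<^sub>0 \<noteq> Z\<^sub>0" using c assms(2) by force
  then obtain w where w: "w \<in> Z\<^sub>0" "w \<notin> F" by blast
  have "bounded_weight E one_weight r (insert w F)"
  proof (rule bounded_weight_insert)
    show "bounded_weight E one_weight r F" using F(2) bounded_weight_subset by blast
    fix C assume C: "C \<subseteq> insert w F" "w \<in> C" "linked E C"
    have CV: "C \<subseteq> V" "a \<notin> C" using C(1) F(1) w(1) Z0(1) a(2) by blast+
    have "C \<subseteq> Z\<^sub>0"
      by (rule linked_within[OF C(3) CV(1)]) (use C(2) w(1) pendant CV in blast)+
    then have "C \<subseteq> insert w (F \<inter> Z\<^sub>0)" using C(1) by blast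
    then have "card C \<le> card (insert w (F \<inter> Z\<^sub>0))" using fin by (intro card_mono) auto
    also have "\<dots> \<le> r" using c fin w by simp
    finally show "sum one_weight C \<le> r" by simp
  qed
  then show "\<exists>u\<in>V - {a} - F. bounded_weight E one_weight r (insert u (F \<union> {}))"
    using w Z0(1) a(2) by auto
qed

end

section \<open>Clique cycles with stars\<close>

lemma reachable_induced:
  "u \<rightarrow>\<^sup>*\<^bsub>with_proj G \<restriction> A\<^esub> v \<longleftrightarrow> (u, v) \<in> rtrancl_on A {(u, v). (u, v) \<in> parcs G \<and> u \<in> A \<and> v \<in> A}"
proof -
  have "arcs_ends (with_proj G \<restriction> A) = {(u, v). (u, v) \<in> parcs G \<and> u \<in> A \<and> v \<in> A}"
    by (force simp: arcs_ends_def arc_to_ends_def induce_subgraph_def)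
  then show ?thesis by (simp add: reachable_def)
qed

text \<open>By symmetry the strong components are the reachability classes in \<open>A\<close>: a
  nonempty connected set lies in one class, and each class is connected.\<close>

lemma bounded_weight_iff_sccs:
  assumes "pair_graph G" "A \<subseteq> pverts G"
  shows "(\<forall>C\<in>pre_digraph.sccs_verts (with_proj G \<restriction> A). card C \<le> r) \<longleftrightarrow>
    bounded_weight (\<lambda>u v. (u, v) \<in> parcs G) one_weight r A"
proof -
  interpret pair_graph G by fact
  define R where "R = {(u, v). (u, v) \<in> parcs G \<and> u \<in> A \<and> v \<in> A}"
  define reach where "reach u v \<longleftrightarrow> (u, v) \<in> rtrancl_on A R" for u v
  have R_sym: "(v, u) \<in> R" if "(u, v) \<in> R" for u v
    using that pair_sym_arcs unfolding R_def symmetric_def by (auto dest: symD)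
  have inA: "v \<in> A" if "reach u v" for u v
    using that unfolding reach_def by induction (auto simp: R_def)
  have refl: "reach u u \<longleftrightarrow> u \<in> A" for u
    using inA[of u u] rtrancl_on_refl[of u A R] by (auto simp: reach_def)
  have trans: "reach u w" if "reach u v" "reach v w" for u v w
    using that unfolding reach_def by (rule rtrancl_on_trans)
  have step: "reach u v" if "(u, v) \<in> R" for u v
    using that refl[of u] unfolding reach_def by (auto simp: R_def intro: rtrancl_on_into_rtrancl_on)
  have sym: "reach v u" if "reach u v" for u v
    using that[unfolded reach_def]
  proof induction
    case base
    then show ?case using refl by blast
  next
    case (step w y)
    then show ?case using trans \<open>\<And>u v. (u, v) \<in> R \<Longrightarrow> reach u v\<close> R_sym by blast
  qed
  have sccs: "C \<in> pre_digraph.sccs_verts (with_proj G \<restriction> A) \<longleftrightarrow>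
    C \<noteq> {} \<and> (\<forall>u\<in>C. \<forall>v\<in>C. reach u v) \<and> (\<forall>u\<in>C. \<forall>v. v \<notin> C \<longrightarrow> \<not> reach u v \<or> \<not> reach v u)" for C
    unfolding pre_digraph.sccs_verts_def reachable_induced reach_def R_def by simp
  have finA: "finite A" using assms(2) pair_finite_verts finite_subset by blast
  show ?thesis
  proof
    assume b: "\<forall>C\<in>pre_digraph.sccs_verts (with_proj G \<restriction> A). card C \<le> r"
    show "bounded_weight (\<lambda>u v. (u, v) \<in> parcs G) one_weight r A"
      unfolding bounded_weight_def
    proof (intro allI impI)
      fix C assume C: "C \<subseteq> A" "linked (\<lambda>u v. (u, v) \<in> parcs G) C"
      show "sum one_weight C \<le> r"
      proof (cases "C = {}")
        case False
        then obtain u where u: "u \<in> C" by blast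
        define S where "S = {v. reach u v}"
        have uS: "u \<in> S" using u C(1) refl by (auto simp: S_def)
        have "reach v w" if "v \<in> S" "w \<in> S" for v w
          using trans[OF sym, of u v w] that by (simp add: S_def)
        moreover have "w \<in> S" if "v \<in> S" "reach v w" for v w
          using trans[OF _ that(2), of u] that(1) by (simp add: S_def)
        ultimately have "S \<in> pre_digraph.sccs_verts (with_proj G \<restriction> A)"
          unfolding sccs using uS by blast
        then have "card S \<le> r" using b by blast
        moreover have "S \<inter> C = C"
        proof (rule linkedD[OF C(2)])
          fix v w assume "v \<in> S \<inter> C" "w \<in> C" "(v, w) \<in> parcs G"
          then have "(v, w) \<in> R" "reach u v" using C(1) by (auto simp: R_def S_def)
          then show "w \<in> S \<inter> C" using trans[OF _ step] \<open>w \<in> C\<close> by (simp add: S_def)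
        qed (use u uS in auto)
        moreover have "finite S" by (rule finite_subset[OF _ finA]) (use inA in \<open>auto simp: S_def\<close>)
        ultimately have "card C \<le> r" by (metis Int_lower1 card_mono order_trans)
        then show ?thesis by simp
      qed simp
    qed
  next
    assume b: "bounded_weight (\<lambda>u v. (u, v) \<in> parcs G) one_weight r A"
    show "\<forall>C\<in>pre_digraph.sccs_verts (with_proj G \<restriction> A). card C \<le> r"
    proof
      fix C assume "C \<in> pre_digraph.sccs_verts (with_proj G \<restriction> A)"
      then have C: "\<And>u v. u \<in> C \<Longrightarrow> v \<in> C \<Longrightarrow> reach u v"
        "\<And>u v. u \<in> C \<Longrightarrow> reach u v \<Longrightarrow> v \<in> C"
        unfolding sccs using sym by blast+
      have "linked (\<lambda>u v. (u, v) \<in> parcs G) C"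
      proof (rule linkedI)
        fix X assume X: "X \<subseteq> C" "X \<noteq> {}"
          and cl: "\<And>x y. x \<in> X \<Longrightarrow> y \<in> C \<Longrightarrow> (x, y) \<in> parcs G \<Longrightarrow> y \<in> X"
        obtain u where u: "u \<in> X" using X(2) by blast
        have "v \<in> X" if "reach u v" for v
          using that[unfolded reach_def]
        proof (induction rule: rtrancl_on_induct)
          case base
          show ?case by (rule u)
        next
          case (step w y)
          then have "y \<in> C" using C(2)[of w y] X(1) \<open>\<And>u v. (u, v) \<in> R \<Longrightarrow> reach u v\<close> by blast
          then show ?case using cl[of w y] step by (auto simp: R_def)
        qed
        then show "C \<subseteq> X" using C(1) u X(1) by blast
      qed
      moreover have "C \<subseteq> A" using C(1) inA by blast
      ultimately show "card C \<le> r" using bounded_weightD[OF b] by fastforce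
    qed
  qed
qed

lemma Ind_eq_bounded_faces:
  assumes "pair_graph G"
  shows "Ind r G = bounded_faces (\<lambda>u v. (u, v) \<in> parcs G) one_weight r (pverts G) {}"
  unfolding Ind_def r_independent_def bounded_faces_def
  by (simp add: bounded_weight_iff_sccs[OF assms] cong: conj_cong)

section \<open>Rotating and opening a clique cycle\<close>

text \<open>Allows the centre of a large star to get the last index. The shift permutes the indices
  and commutes with the cyclic successor.\<close>

lemma clique_cycle_rotate:
  assumes "clique_cycle n B x H"
  shows "clique_cycle n (\<lambda>i. B ((i + k) mod n)) (\<lambda>i. x ((i + k) mod n)) H"
    and "(\<lambda>i. x ((i + k) mod n)) ` {..<n} = x ` {..<n}"
proof -
  define s where "s i = (i + k) mod n" for i
  have n: "3 \<le> n" using assms by (simp add: clique_cycle_def)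
  have s_less: "s i < n" for i using n by (simp add: s_def)
  have s_Suc: "s (Suc i mod n) = Suc (s i) mod n" for i by (simp add: s_def mod_simps)
  have s_inj: "inj_on s {..<n}"
  proof (rule inj_onI)
    fix i j assume ij: "i \<in> {..<n}" "j \<in> {..<n}" "s i = s j"
    then have "int (i + k) mod int n = int (j + k) mod int n"
      unfolding s_def by (metis of_nat_mod)
    then have "int i mod int n = int j mod int n"
      by (metis add_diff_cancel_right' mod_diff_left_eq of_nat_add)
    then show "i = j" using ij(1,2) by simp
  qed
  have s_surj: "s ` {..<n} = {..<n}"
    by (rule endo_inj_surj[OF _ _ s_inj]) (use s_less in auto)
  have s_eq: "s i = s j \<longleftrightarrow> i = j" if "i < n" "j < n" for i j
    using s_inj that by (auto simp: inj_on_eq_iff)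
  have "inj_on (x \<circ> s) {..<n}"
    using assms s_inj s_surj by (intro comp_inj_on) (auto simp: clique_cycle_def)
  moreover have "B (s i) \<inter> B (s (Suc i mod n)) = {x (s i)}" if "i < n" for i
    unfolding s_Suc using assms s_less by (simp add: clique_cycle_def)
  moreover have "B (s i) \<inter> B (s j) = {}"
    if ij: "i < n" "j < n" "i \<noteq> j" "j \<noteq> Suc i mod n" "i \<noteq> Suc j mod n" for i j
  proof -
    have "s i \<noteq> s j" "s j \<noteq> Suc (s i) mod n" "s i \<noteq> Suc (s j) mod n"
      unfolding s_Suc[symmetric] using ij n by (simp_all add: s_eq)
    then show ?thesis using assms s_less by (simp add: clique_cycle_def)
  qed
  moreover have "(\<lambda>i. B (s i)) ` {..<n} = B ` {..<n}" using s_surj by (metis image_image)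
  ultimately have "clique_cycle n (\<lambda>i. B (s i)) (\<lambda>i. x (s i)) H"
    using assms s_less unfolding clique_cycle_def o_def by metis
  then show "clique_cycle n (\<lambda>i. B ((i + k) mod n)) (\<lambda>i. x ((i + k) mod n)) H"
    by (simp add: s_def)
  have "(\<lambda>i. x (s i)) ` {..<n} = x ` {..<n}" using s_surj by (metis image_image)
  then show "(\<lambda>i. x ((i + k) mod n)) ` {..<n} = x ` {..<n}" by (simp add: s_def)
qed

text \<open>Away from \<open>x (n - 1)\<close> the cycle opens into a path of cliques: the only pair
  that is consecutive by wrapping around is \<open>B (n - 1)\<close>, \<open>B 0\<close>, and it
  meets just there.\<close>

lemma clique_cycle_shared_vertex:
  assumes "clique_cycle n B x H" "i < j" "j < n" "v \<in> B i" "v \<in> B j" "v \<noteq> x (n - 1)"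
  shows "j = Suc i \<and> v = x i"
proof (cases "j = Suc i")
  case True
  then have "B i \<inter> B j = {x i}" using assms(1-3) unfolding clique_cycle_def by (metis Suc_lessD mod_less)
  then show ?thesis using True assms(4,5) by blast
next
  case False
  have "Suc i mod n = Suc i" using assms(2,3) by simp
  then have "i = Suc j mod n"
    using assms False unfolding clique_cycle_def by (metis disjoint_iff less_trans nat_neq_iff)
  then have j: "Suc j = n" using assms(2,3) by (metis Suc_lessI less_Suc_eq mod_less nat_neq_iff)
  have "B j \<inter> B (Suc j mod n) = {x j}" using assms(1,3) unfolding clique_cycle_def by blast
  then have "B j \<inter> B i = {x j}" using \<open>i = _\<close> by simp
  then show ?thesis using assms(4-6) j by auto
qed

section \<open>The block forest left after deleting the centre of a large star\<close>

lemma shellable_Ind_last_star: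
  assumes r: "1 \<le> r" and cc: "clique_cycle n B x H" and A: "A \<subseteq> x ` {..<n}"
    and star: "\<And>a. a \<in> A \<Longrightarrow> star_clique a (S a)"
    and star_H: "\<And>a. a \<in> A \<Longrightarrow> pverts (S a) \<inter> pverts H = {a}"
    and star_disj: "\<And>a b. a \<in> A \<Longrightarrow> b \<in> A \<Longrightarrow> a \<noteq> b \<Longrightarrow> pverts (S a) \<inter> pverts (S b) = {}"
    and last: "x (n - 1) \<in> A" "r + 1 \<le> card (pverts (S (x (n - 1))))"
    and G: "G = graph_Union (insert H (S ` A))"
  shows "shellable (Ind r G)"
proof -
  define a where "a = x (n - 1)"
  define E where "E u v \<longleftrightarrow> (u, v) \<in> parcs G" for u v
  define V where "V = pverts G"
  have finA: "finite A" using A finite_surj by blast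
  have pg: "pair_graph G"
    unfolding G using finA cc star
    by (intro pair_graph_graph_Union) (auto intro: pair_graph_clique_cycle pair_graph_star_clique)
  then interpret G: pair_graph G .
  have finV: "finite V" using G.pair_finite_verts by (simp add: V_def)
  have E_sym: "symp E"
    using G.pair_sym_arcs by (auto simp: symp_def E_def symmetric_def dest: symD)
  have n: "3 \<le> n" and Bx: "\<And>i. i < n \<Longrightarrow> B i \<inter> B (Suc i mod n) = {x i}"
    and H: "H = graph_Union (clique_on ` B ` {..<n})"
    using cc by (auto simp: clique_cycle_def)
  have VH: "pverts H = (\<Union>i<n. B i)" by (simp add: H graph_Union_def clique_on_def)
  have EH: "(u, v) \<in> parcs H \<longleftrightarrow> u \<noteq> v \<and> (\<exists>i<n. u \<in> B i \<and> v \<in> B i)" for u v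
    by (auto simp: H graph_Union_def clique_on_def)
  have "\<forall>b\<in>A. \<exists>\<C>. finite \<C> \<and> (\<forall>K\<in>\<C>. finite K \<and> b \<in> K) \<and> (\<forall>K\<in>\<C>. \<forall>L\<in>\<C>. K \<noteq> L \<longrightarrow> K \<inter> L = {b}) \<and>
      S b = graph_Union (insert (clique_on {b}) (clique_on ` \<C>))"
    using star unfolding star_clique_def by blast
  from bchoice[OF this] obtain \<C> where "\<forall>b\<in>A. finite (\<C> b) \<and> (\<forall>K\<in>\<C> b. finite K \<and> b \<in> K) \<and>
      (\<forall>K\<in>\<C> b. \<forall>L\<in>\<C> b. K \<noteq> L \<longrightarrow> K \<inter> L = {b}) \<and>
      S b = graph_Union (insert (clique_on {b}) (clique_on ` \<C> b))" ..
  then have \<C>: "\<And>b. b \<in> A \<Longrightarrow> finite (\<C> b)" "\<And>b K. b \<in> A \<Longrightarrow> K \<in> \<C> b \<Longrightarrow> b \<in> K"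
      "\<And>b K L. b \<in> A \<Longrightarrow> K \<in> \<C> b \<Longrightarrow> L \<in> \<C> b \<Longrightarrow> K \<noteq> L \<Longrightarrow> K \<inter> L = {b}"
      "\<And>b. b \<in> A \<Longrightarrow> S b = graph_Union (insert (clique_on {b}) (clique_on ` \<C> b))"
    by blast+
  have VS: "pverts (S b) = insert b (\<Union>(\<C> b))" if "b \<in> A" for b
    by (simp add: \<C>(4)[OF that] graph_Union_def clique_on_def)
  have ES: "(u, v) \<in> parcs (S b) \<longleftrightarrow> u \<noteq> v \<and> (\<exists>K\<in>\<C> b. u \<in> K \<and> v \<in> K)" if "b \<in> A" for u v b
    by (auto simp: \<C>(4)[OF that] graph_Union_def clique_on_def)
  have V: "V = pverts H \<union> (\<Union>b\<in>A. pverts (S b))" by (simp add: V_def G graph_Union_def)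
  have "E u v \<longleftrightarrow> (u, v) \<in> parcs H \<or> (\<exists>b\<in>A. (u, v) \<in> parcs (S b))" for u v
    by (auto simp: E_def G graph_Union_def)
  then have E_disj: "E u v \<longleftrightarrow> (u \<noteq> v \<and> (\<exists>i<n. u \<in> B i \<and> v \<in> B i)) \<or>
      (\<exists>b\<in>A. u \<noteq> v \<and> (\<exists>K\<in>\<C> b. u \<in> K \<and> v \<in> K))" for u v
    by (simp add: EH ES cong: bex_cong)
  have E: "E u v \<longleftrightarrow> u \<noteq> v \<and> ((\<exists>i<n. u \<in> B i \<and> v \<in> B i) \<or> (\<exists>b\<in>A. \<exists>K\<in>\<C> b. u \<in> K \<and> v \<in> K))" for u v
    unfolding E_disj by auto
  have AH: "b \<in> pverts H" if "b \<in> A" for b using star_H[OF that] by blast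
  have K_S: "K \<subseteq> pverts (S b)" if "b \<in> A" "K \<in> \<C> b" for b K using VS[OF that(1)] that(2) by blast
  have K_H: "v = b" if "b \<in> A" "K \<in> \<C> b" "v \<in> K" "v \<in> pverts H" for b K v
    using star_H[OF that(1)] K_S[OF that(1,2)] that(3,4) by blast
  have K_unique: "b = b' \<and> K = K'"
    if "b \<in> A" "K \<in> \<C> b" "b' \<in> A" "K' \<in> \<C> b'" "v \<in> K" "v \<in> K'" "v \<notin> pverts H" for b b' K K' v
  proof -
    have "b = b'" using star_disj[of b b'] K_S that by blast
    moreover have "v \<noteq> b" using AH that(1,7) by blast
    then have "K \<inter> K' \<noteq> {b}" using that(5,6) by blast
    then have "K = K'" using \<C>(3)[of b K K'] that(1,2,4) \<open>b = b'\<close> by blast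
    ultimately show ?thesis by blast
  qed

  define I where "I = Inl ` {..<n} \<union> Inr ` (SIGMA b:A. \<C> b)"
  define Q where "Q = case_sum B (snd :: 'a \<times> 'a set \<Rightarrow> 'a set)"
  have bex_I: "(\<exists>i\<in>I. P i) \<longleftrightarrow> (\<exists>j<n. P (Inl j)) \<or> (\<exists>b\<in>A. \<exists>K\<in>\<C> b. P (Inr (b, K)))" for P
    unfolding I_def by fast
  define home where "home v = (if v \<in> pverts H then Inl (LEAST j. j < n \<and> v \<in> B j)
    else Inr (SOME bK. bK \<in> (SIGMA b:A. \<C> b) \<and> v \<in> snd bK))" for v
  \<comment> \<open>For \<open>j = 0\<close> the truncated subtraction yields the spurious top
    \<open>x 0\<close>; it is ruled out by depth, since \<open>di (Inl 0) = 0\<close>, and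
    \<open>B 0\<close> is a root.\<close>
  define p where "p = case_sum (\<lambda>j. x (j - 1)) (fst :: 'a \<times> 'a set \<Rightarrow> 'a)"
  \<comment> \<open>Cliques get even depths and each vertex one more than its home;
    \<open>2 * n\<close> places the star-cliques below all cycle vertices.\<close>
  define di where "di = case_sum (\<lambda>j. 2 * j) (\<lambda>bK :: 'a \<times> 'a set. 2 * n)"
  define dv where "dv v = Suc (di (home v))" for v
  have home_H: "\<exists>j<n. home v = Inl j \<and> v \<in> B j \<and> (\<forall>i<n. v \<in> B i \<longrightarrow> j \<le> i)" if v: "v \<in> pverts H" for v
  proof -
    define j where "j = (LEAST j. j < n \<and> v \<in> B j)"
    have "\<exists>j. j < n \<and> v \<in> B j" using v VH by auto
    then have "j < n \<and> v \<in> B j" unfolding j_def by (rule LeastI_ex)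
    moreover have "j \<le> i" if "i < n" "v \<in> B i" for i unfolding j_def using that by (simp add: Least_le)
    moreover have "home v = Inl j" using v by (simp add: home_def j_def)
    ultimately show ?thesis by blast
  qed
  have home_S: "\<exists>b\<in>A. \<exists>K\<in>\<C> b. home v = Inr (b, K) \<and> v \<in> K" if v: "v \<in> V" "v \<notin> pverts H" for v
  proof -
    obtain b where b: "b \<in> A" "v \<in> pverts (S b)" using v V by blast
    moreover have "v \<noteq> b" using AH[OF b(1)] v(2) by blast
    ultimately obtain K where "K \<in> \<C> b" "v \<in> K" using VS[OF b(1)] by blast
    then have ex: "\<exists>bK. bK \<in> (SIGMA b:A. \<C> b) \<and> v \<in> snd bK"
      using b(1) by (intro exI[of _ "(b, K)"]) simp
    define bK where "bK = (SOME bK. bK \<in> (SIGMA b:A. \<C> b) \<and> v \<in> snd bK)"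
    have "bK \<in> (SIGMA b:A. \<C> b) \<and> v \<in> snd bK" unfolding bK_def by (rule someI_ex[OF ex])
    moreover have "home v = Inr bK" using v by (simp add: home_def bK_def)
    ultimately show ?thesis by (cases bK) auto
  qed
  have rc: "rooted_cliques E (V - {a}) I Q home p dv di"
  proof
    show "finite (V - {a})" using finV by simp
    show "finite I" using finA \<C>(1) by (simp add: I_def)
    show "E u v \<longleftrightarrow> u \<noteq> v \<and> (\<exists>i\<in>I. u \<in> Q i \<and> v \<in> Q i)" for u v
      unfolding E bex_I Q_def by simp
    show "di (home v) < dv v" for v by (simp add: dv_def)
    fix v i assume v: "v \<in> V - {a}" and i: "i \<in> I"
    from i consider j where "i = Inl j" "j < n" | b K where "i = Inr (b, K)" "b \<in> A" "K \<in> \<C> b"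
      unfolding I_def by blast
    then show "v \<in> Q i \<longleftrightarrow> home v = i \<or> p i = v \<and> dv v < di i"
    proof cases
      case 1
      have Bj: "x (j - 1) \<in> B j" "x (j - 1) \<in> pverts H" if "0 < j"
      proof -
        have "Suc (j - 1) mod n = j" using that 1(2) by simp
        then have "B (j - 1) \<inter> B j = {x (j - 1)}" using Bx[of "j - 1"] 1(2) by simp
        then show "x (j - 1) \<in> B j" by blast
        then show "x (j - 1) \<in> pverts H" using VH 1(2) by blast
      qed
      show ?thesis
      proof (cases "v \<in> pverts H")
        case True
        then obtain f where f: "f < n" "home v = Inl f" "v \<in> B f" "\<And>i. i < n \<Longrightarrow> v \<in> B i \<Longrightarrow> f \<le> i"
          using home_H by blast
        have "v \<in> B j \<longleftrightarrow> f = j \<or> (x (j - 1) = v \<and> f < j)"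
        proof
          assume vj: "v \<in> B j"
          then have "f \<le> j" using f(4) 1(2) by blast
          moreover have "x (j - 1) = v" if "f < j"
            using clique_cycle_shared_vertex[OF cc that 1(2) f(3) vj] v by (auto simp: a_def)
          ultimately show "f = j \<or> (x (j - 1) = v \<and> f < j)" by linarith
        next
          assume "f = j \<or> (x (j - 1) = v \<and> f < j)"
          then show "v \<in> B j" using f(3) Bj(1) by auto
        qed
        moreover have "Suc (2 * f) < 2 * j \<longleftrightarrow> f < j" by linarith
        ultimately show ?thesis using f(2) 1(1) by (simp add: Q_def p_def dv_def di_def)
      next
        case False
        then obtain b K where "home v = Inr (b, K)" using home_S v by blast
        moreover have "v \<notin> B j" using False VH 1(2) by blast
        moreover have "x (j - 1) \<noteq> v" if "0 < j" using Bj(2)[OF that] False by blast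
        ultimately show ?thesis using 1(1) by (auto simp: Q_def p_def dv_def di_def)
      qed
    next
      case 2
      show ?thesis
      proof (cases "v \<in> pverts H")
        case True
        then obtain f where f: "f < n" "home v = Inl f" using home_H by blast
        have "v \<in> K \<longleftrightarrow> b = v" using K_H[OF 2(2,3) _ True] \<C>(2)[OF 2(2,3)] by blast
        moreover have "Suc (2 * f) < 2 * n" using f(1) by linarith
        ultimately show ?thesis using f(2) 2(1) by (simp add: Q_def p_def dv_def di_def)
      next
        case False
        then obtain b' K' where K': "b' \<in> A" "K' \<in> \<C> b'" "home v = Inr (b', K')" "v \<in> K'"
          using home_S v by blast
        have "v \<in> K \<longleftrightarrow> b' = b \<and> K' = K" using K_unique[OF 2(2,3) K'(1,2) _ K'(4) False] K'(4) by blast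
        moreover have "b \<noteq> v" using AH[OF 2(2)] False by blast
        ultimately show ?thesis using K'(3) 2(1) by (simp add: Q_def p_def)
      qed
    qed
  qed

  define Z where "Z = pverts (S a) - {a}"
  have aA: "a \<in> A" using last(1) by (simp add: a_def)
  have Z_K: "\<exists>K\<in>\<C> a. z \<in> K" if "z \<in> Z" for z using that VS[OF aA] by (auto simp: Z_def)
  have Z_H: "z \<notin> pverts H" if "z \<in> Z" for z using that star_H[OF aA] by (auto simp: Z_def)
  have pc: "pendant_cluster E V a Z"
  proof
    show "symp E" "finite V" "a \<notin> Z" by (simp_all add: E_sym finV Z_def)
    show "a \<in> V" using AH[OF aA] V by blast
    show "Z \<subseteq> V" using V aA by (auto simp: Z_def)
    show "E a z" if z: "z \<in> Z" for z
      unfolding E using Z_K[OF z] \<C>(2)[OF aA] aA z by (auto simp: Z_def)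
    show "w = a \<or> w \<in> Z" if zw: "z \<in> Z" "w \<in> V" "E z w" for z w
    proof -
      obtain K where K: "K \<in> \<C> a" "z \<in> K" using Z_K[OF zw(1)] by blast
      obtain b L where L: "b \<in> A" "L \<in> \<C> b" "z \<in> L" "w \<in> L"
        using zw(3) Z_H[OF zw(1)] VH unfolding E by blast
      then have "w \<in> K" using K_unique[OF aA K(1) L(1,2) K(2) L(3) Z_H[OF zw(1)]] by blast
      then show ?thesis using K_S[OF aA K(1)] by (auto simp: Z_def)
    qed
  qed
  have "a \<in> pverts (S a)" using VS[OF aA] by blast
  then have "card Z = card (pverts (S a)) - 1" unfolding Z_def by (rule card_Diff_singleton)
  then have "r \<le> card Z" using last(2) by (simp add: a_def)
  then have "vertex_decomposable (bounded_faces E one_weight r V {})"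
    using pendant_cluster.vertex_decomposable_large_cluster[OF pc r]
      rooted_cliques.vertex_decomposable_rooted_cliques[OF rc] by blast
  moreover have "Ind r G = bounded_faces E one_weight r V {}"
    using Ind_eq_bounded_faces[OF pg] unfolding E_def V_def .
  ultimately show ?thesis using vertex_decomposable_imp_shellable by simp
qed

theorem theorem5p5:
  fixes r n :: nat
    and B :: "nat \<Rightarrow> 'a set" and x :: "nat \<Rightarrow> 'a" and A :: "'a set"
    and S :: "'a \<Rightarrow> 'a pair_pre_digraph" and H G :: "'a pair_pre_digraph"
  assumes "1 \<le> r"
    and "clique_cycle n B x H"
    and "A \<subseteq> x ` {..<n}" and "A \<noteq> {}"
    and "\<And>a. a \<in> A \<Longrightarrow> star_clique a (S a)"
    and "\<And>a. a \<in> A \<Longrightarrow> pverts (S a) \<inter> pverts H = {a}"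
    and "\<And>a b. a \<in> A \<Longrightarrow> b \<in> A \<Longrightarrow> a \<noteq> b \<Longrightarrow> pverts (S a) \<inter> pverts (S b) = {}"
    and "\<exists>a\<in>A. r + 1 \<le> card (pverts (S a))"
    and "G = graph_Union (insert H (S ` A))"
  shows "shellable (Ind r G)"
proof -
  obtain b where b: "b \<in> A" "r + 1 \<le> card (pverts (S b))" using assms(8) by blast
  then obtain k where k: "k < n" "b = x k" using assms(3) by blast
  \<comment> \<open>Since \<open>n - 1 + Suc k = n + k\<close>, this rotation gives the old index
    \<open>k\<close> the position \<open>n - 1\<close>.\<close>
  let ?x = "\<lambda>i. x ((i + Suc k) mod n)"
  have "(n - 1 + Suc k) mod n = k" using k(1) by simp
  then have last: "?x (n - 1) = b" using k(2) by metis
  show ?thesis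
  proof (rule shellable_Ind_last_star[OF assms(1) clique_cycle_rotate(1)[OF assms(2)] _ assms(5-7)])
    show "A \<subseteq> ?x ` {..<n}" unfolding clique_cycle_rotate(2)[OF assms(2)] by (rule assms(3))
    show "?x (n - 1) \<in> A" "r + 1 \<le> card (pverts (S (?x (n - 1))))" unfolding last by (fact b)+
  qed (assumption | rule assms(9))+
qed

end
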